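(* Let $\tau,\tau_{ij}$ ($i,j=1,\dots,N$) be $\tau$-functions of the $N$-component BKP hierarchy, with associated matrix $\mathcal T(\boldsymbol t)=(\tau_{ij}(\boldsymbol t))$, Baker matrix $\psi(z,\boldsymbol t)$, matrix $G(\boldsymbol t)=\mathcal T^{-1}(\boldsymbol t)\mathcal T^{\mathrm t}(\boldsymbol t)$ with rows $\boldsymbol g_1(\boldsymbol t),\dots,\boldsymbol g_N(\boldsymbol t)$, and vertex operators $\mathbb V_i(p)$, as defined in the context. Fix $i\in\{1,\dots,N\}$ and $p\in\mathbb C$ with $|p|>1$. Then the Ribaucour transformation with transformation data $$\zeta_k(\boldsymbol t):=\psi_{ki}(-p,\boldsymbol t),\qquad k=1,\dots,N,$$ is given by $$\mathcal R(\boldsymbol g_j)=(-1)^{\delta_{ij}}\,\mathbb V_i(p)\boldsymbol g_j,\qquad j=1,\dots,N;$$ that is, $$(-1)^{\delta_{ij}}\,\boldsymbol g_j(\boldsymbol t+[1/p]\boldsymbol e_i)=\boldsymbol g_j(\boldsymbol t)-\frac{2\,\psi_{ji}(-p,\boldsymbol t)}{\sum_{k=1}^N\psi_{ki}^2(-p,\boldsymbol t)}\sum_{k=1}^N\psi_{ki}(-p,\boldsymbol t)\,\boldsymbol g_k(\boldsymbol t),\qquad j=1,\dots,N,$$ for all $\boldsymbol t\in\mathcal D$ such that $\mathcal T(\boldsymbol t)$ and $\mathcal T(\boldsymbol t+[1/p]\boldsymbol e_i)$ are invertible and the series $\xi(z,\boldsymbol t_i)$ converges absolutely in a neighbourhood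 of $\{|z|\le|p|\}$.
   Context: **Times.** Fix $N\ge 1$. Times are $\boldsymbol t=(\boldsymbol t_1,\dots,\boldsymbol t_N)$ with $\boldsymbol t_i=(t_{i,1},t_{i,3},t_{i,5},\dots)\in\mathbb C^\infty$; write $u_i:=t_{i,1}$. Put $\xi(z,\boldsymbol t_i):=\sum_{n\ge 0}z^{2n+1}t_{i,2n+1}$ and $[1/z]:=2\big(\tfrac1z,\tfrac1{3z^3},\tfrac1{5z^5},\dots\big)$. The time $\boldsymbol t\pm[1/z]\boldsymbol e_j$ is obtained from $\boldsymbol t$ by replacing $\boldsymbol t_j$ by $\boldsymbol t_j\pm[1/z]$. The vertex operator $\mathbb V_i(z)$ acts by $\mathbb V_i(z)f(\boldsymbol t):=f(\boldsymbol t+[1/z]\boldsymbol e_i)$. $\mathcal D$ denotes a set of ("suitable") times such that: for $\boldsymbol t\in\mathcal D$ each series $\xi(z,\boldsymbol t_i)$ converges absolutely in a neighbourhood of the closed unit disc; $\mathcal D$ is stable under $\boldsymbol t\mapsto\boldsymbol t\pm[1/z]\boldsymbol e_j$ for $|z|>1$; and $\mathcal D$ is stable under sufficiently small changes of any finite number of the coordinates $t_{i,2l+1}$. **$\tau$-functions of the $N$-component BKP hierarchy.** These are complex functions $\tau,\tau_{ij}$ on $\mathcal D$ with $\tau_{ij}+\tau_{ji}=0$ for $i\ne j$ and $2\tau_{ii}=\tau$ for all $i$, satisfying the bilinear equation that defines the hierarchy: for all $\boldsymbol t,\boldsymbol t'\in\mathcal D$ and $i,j=1,\dots,N$, $$\sum_{k=1}^N\int_{S^1}\frac{\mathrm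 dz}{2\pi \mathrm i z}\,e^{\xi(z,\boldsymbol t_k)-\xi(z,\boldsymbol t'_k)}\,\tau_{ik}(\boldsymbol t-[1/z]\boldsymbol e_k)\,\tau_{jk}(\boldsymbol t'+[1/z]\boldsymbol e_k)=\sum_{k=1}^N\tau_{ki}(\boldsymbol t)\tau_{kj}(\boldsymbol t'),$$ where $S^1=\{|z|=1\}$ is positively oriented. **Analyticity convention.** The functions $z\mapsto\tau_{ij}(\boldsymbol t-[1/z]\boldsymbol e_j)$, defined for $|z|>1$, extend holomorphically to a neighbourhood of $\{|z|\ge 1\}\cup\{\infty\}$, with value $\tau_{ij}(\boldsymbol t)$ at $z=\infty$. This extension is used on $S^1$, and $\tau_{jk}(\boldsymbol t'+[1/z]\boldsymbol e_k)$ on $S^1$ is its value at $-z$. The extension is jointly holomorphic in $z$ and any finite number of time coordinates, the neighbourhood in $z$ being locally uniform in these coordinates. **Baker matrix.** Let $\mathcal T(\boldsymbol t):=(\tau_{ij}(\boldsymbol t))_{i,j=1}^N$, and consider times $\boldsymbol t\in\mathcal D$ with $\mathcal T(\boldsymbol t)$ invertible. Let $\psi_0(z,\boldsymbol t):=\operatorname{diag}(e^{\xi(z,\boldsymbol t_1)},\dots,e^{\xi(z,\boldsymbol t_N)})$, $\varphi_{ij}(z,\boldsymbol t):=\tau_{ij}(\boldsymbol t-[1/z]\boldsymbol e_j)\,e^{\xi(z,\boldsymbol t_j)}$, and $\psi(z,\boldsymbol t):=\mathcal T^{-1}(\boldsymbol t)\varphi(z,\boldsymbol t)$ (the Baker function;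 its $i$-th column is defined at any $z$ with $|z|\ge1$ at which $\xi(z,\boldsymbol t_i)$ converges). Then $\psi=\chi\psi_0$ with $\chi(z,\boldsymbol t)=1+\beta(\boldsymbol t)z^{-1}+O(z^{-2})$ as $z\to\infty$, and this defines $\beta(\boldsymbol t)=(\beta_{ij}(\boldsymbol t))$. The superscript $\mathrm t$ denotes transpose. With $G:=\mathcal T^{-1}\mathcal T^{\mathrm t}$ the bilinear equation reads $$\int_{S^1}\frac{\mathrm dz}{2\pi \mathrm i z}\,\psi(z,\boldsymbol t)\,\psi^{\mathrm t}(-z,\boldsymbol t')=G(\boldsymbol t)\,G^{\mathrm t}(\boldsymbol t').$$ The rows $\boldsymbol g_j$ of $G$ form an orthonormal frame (for the bilinear dot product) whose rotation coefficients are the $\beta_{ij}$, $i\neq j$. **Ribaucour transformation.** Given rotation coefficients $\beta_{kl}$ ($k\ne l$) with orthonormal frame $\{\boldsymbol g_j\}_{j=1}^N$ satisfying $\partial\boldsymbol g_k/\partial u_l=\beta_{kl}\boldsymbol g_l$ for $k\neq l$, and transformation data $\zeta_1,\dots,\zeta_N$, i.e. functions with $\partial\zeta_k/\partial u_l=\beta_{kl}\zeta_l$ for $k\ne l$, the Ribaucour transformation of the frame is $$\mathcal R(\boldsymbol g_j):=\boldsymbol g_j-2\,\frac{\zeta_j}{\sum_{k=1}^N\zeta_k^2}\sum_{k=1}^N\zeta_k\boldsymbol g_k,\qquad j=1,\dots,N.$$ *)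

theory Defs
  imports "HOL-Complex_Analysis.Complex_Analysis" "HOL-Library.Landau_Symbols"
begin

section \<open>Times\<close>

text \<open>The entry \<open>t i n\<close> is the time with index \<open>2 n + 1\<close> of the \<open>i\<close>-th component; in particular
  \<open>t i 0\<close> is \<open>u_i\<close>. The number \<open>N\<close> of components is the cardinality of the index type.\<close>

type_synonym 'n times = "'n \<Rightarrow> nat \<Rightarrow> complex"

definition xi :: "complex \<Rightarrow> (nat \<Rightarrow> complex) \<Rightarrow> complex" where
  "xi z s = (\<Sum>n. z ^ (2 * n + 1) * s n)"

text \<open>Absolute convergence of \<open>xi\<close> in a neighbourhood of the closed disc of radius \<open>R\<close>; by
  compactness of that disc, open discs of larger radius suffice as neighbourhoods.\<close>

definition xi_converges :: "real \<Rightarrow> (nat \<Rightarrow> complex) \<Rightarrow> bool" where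
  "xi_converges R s \<longleftrightarrow>
     (\<exists>r>R. \<forall>z\<in>ball 0 r. summable (\<lambda>n. norm (z ^ (2 * n + 1) * s n)))"

text \<open>The sequence \<open>2 (w, w^3 / 3, w^5 / 5, \<dots>)\<close>, so that \<open>[1/z]\<close> is \<open>bracket (1 / z)\<close>. It is odd
  in \<open>w\<close>: the time \<open>t - [1/z] e_j\<close> is \<open>shift j (- 1 / z) t\<close>.\<close>

definition bracket :: "complex \<Rightarrow> nat \<Rightarrow> complex" where
  "bracket w n = 2 * (w ^ (2 * n + 1) / of_nat (2 * n + 1))"

definition shift :: "'n \<Rightarrow> complex \<Rightarrow> 'n times \<Rightarrow> 'n times" where
  "shift j w t = t(j := (\<lambda>n. t j n + bracket w n))"

lemma bracket_minus: "bracket (- w) n = - bracket w n"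
  by (simp add: bracket_def)

lemma shift_minus: "shift j (- w) t = t(j := (\<lambda>n. t j n - bracket w n))"
  by (simp add: shift_def bracket_minus)

definition vertex_op :: "'n \<Rightarrow> complex \<Rightarrow> ('n times \<Rightarrow> 'b) \<Rightarrow> 'n times \<Rightarrow> 'b" where
  "vertex_op i z f t = f (shift i (1 / z) t)"

text \<open>Changes of the finitely many coordinates in \<open>F\<close> by less than \<open>d\<close>.\<close>

definition polydisc :: "('n \<times> nat) set \<Rightarrow> 'n times \<Rightarrow> real \<Rightarrow> 'n times set" where
  "polydisc F t d =
     {t'. \<forall>i n. if (i, n) \<in> F then norm (t' i n - t i n) < d else t' i n = t i n}"

definition suitable_times :: "'n times set \<Rightarrow> bool" where
  "suitable_times D \<longleftrightarrow>
     (\<forall>t\<in>D. \<forall>i. xi_converges 1 (t i)) \<and>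
     (\<forall>t\<in>D. \<forall>j z. norm z > 1 \<longrightarrow> shift j (1 / z) t \<in> D \<and> shift j (- 1 / z) t \<in> D) \<and>
     (\<forall>t\<in>D. \<forall>F. finite F \<longrightarrow> (\<exists>d>0. polydisc F t d \<subseteq> D))"

section \<open>Tau functions\<close>

text \<open>Complex (Frechet) differentiability at \<open>(t, w)\<close> in \<open>w\<close> and the coordinates in \<open>F\<close> jointly.\<close>

definition jointly_cdifferentiable ::
  "('n \<times> nat) set \<Rightarrow> ('n times \<Rightarrow> complex \<Rightarrow> complex) \<Rightarrow> 'n times \<Rightarrow> complex \<Rightarrow> bool" where
  "jointly_cdifferentiable F f t w \<longleftrightarrow>
     (\<exists>a b. \<forall>e>0. \<exists>d>0. \<forall>t'\<in>polydisc F t d. \<forall>w'\<in>ball w d.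
        norm (f t' w' - f t w - (a * (w' - w) + (\<Sum>(i, n)\<in>F. b i n * (t' i n - t i n))))
          \<le> e * (norm (w' - w) + (\<Sum>(i, n)\<in>F. norm (t' i n - t i n))))"

text \<open>\<open>E i j t\<close> is the holomorphic extension of \<open>z \<mapsto> \<tau>_ij (t - [1/z] e_j)\<close>, written in the
  coordinate \<open>w = 1 / z\<close>, which turns the neighbourhood of \<open>{|z| \<ge> 1} \<union> {\<infinity>}\<close> into a
  neighbourhood of the closed unit disc. Its values on \<open>|w| \<le> 1\<close> are determined by \<open>T\<close>.\<close>

definition tau_extension ::
  "'n times set \<Rightarrow> ('n \<Rightarrow> 'n \<Rightarrow> 'n times \<Rightarrow> complex)
     \<Rightarrow> ('n \<Rightarrow> 'n \<Rightarrow> 'n times \<Rightarrow> complex \<Rightarrow> complex) \<Rightarrow> bool" where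
  "tau_extension D T E \<longleftrightarrow>
     (\<forall>t\<in>D. \<forall>i j.
        (\<forall>z. norm z > 1 \<longrightarrow> E i j t (1 / z) = T i j (shift j (- 1 / z) t)) \<and>
        E i j t 0 = T i j t \<and>
        (\<exists>r>1. E i j t holomorphic_on ball 0 r) \<and>
        (\<forall>F. finite F \<longrightarrow>
           (\<exists>r>1. \<exists>d>0. \<forall>t'\<in>polydisc F t d. \<forall>w\<in>ball 0 r.
              jointly_cdifferentiable F (E i j) t' w)))"

text \<open>In the bilinear equation, \<open>\<tau>_jk (t' + [1/z] e_k)\<close> on the unit circle is the extension
  evaluated at \<open>-z\<close>, that is, at \<open>w = - 1 / z\<close>.\<close>

locale bkp_tau =
  fixes D :: "'n::finite times set"
    and tau :: "'n times \<Rightarrow> complex"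
    and T :: "'n \<Rightarrow> 'n \<Rightarrow> 'n times \<Rightarrow> complex"
    and E :: "'n \<Rightarrow> 'n \<Rightarrow> 'n times \<Rightarrow> complex \<Rightarrow> complex"
  assumes times: "suitable_times D"
    and antisym: "\<And>t i j. t \<in> D \<Longrightarrow> i \<noteq> j \<Longrightarrow> T i j t + T j i t = 0"
    and diag: "\<And>t i. t \<in> D \<Longrightarrow> 2 * T i i t = tau t"
    and extension: "tau_extension D T E"
    and bilinear: "\<And>t t' i j. t \<in> D \<Longrightarrow> t' \<in> D \<Longrightarrow>
      (\<Sum>k\<in>UNIV. contour_integral (circlepath 0 1)
         (\<lambda>z. 1 / (2 * of_real pi * \<i> * z) * exp (xi z (t k) - xi z (t' k))
               * E i k t (1 / z) * E j k t' (- 1 / z)))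
      = (\<Sum>k\<in>UNIV. T k i t * T k j t')"

section \<open>Baker matrix\<close>

definition tau_matrix ::
  "('n::finite \<Rightarrow> 'n \<Rightarrow> 'n times \<Rightarrow> complex) \<Rightarrow> 'n times \<Rightarrow> complex^'n^'n" where
  "tau_matrix T t = (\<chi> i j. T i j t)"

definition psi0 :: "complex \<Rightarrow> ('n::finite) times \<Rightarrow> complex^'n^'n" where
  "psi0 z t = (\<chi> i j. if i = j then exp (xi z (t i)) else 0)"

definition phi ::
  "('n::finite \<Rightarrow> 'n \<Rightarrow> 'n times \<Rightarrow> complex \<Rightarrow> complex) \<Rightarrow> complex \<Rightarrow> 'n times \<Rightarrow> complex^'n^'n" where
  "phi E z t = (\<chi> i j. E i j t (1 / z) * exp (xi z (t j)))"

definition psi ::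
  "('n::finite \<Rightarrow> 'n \<Rightarrow> 'n times \<Rightarrow> complex) \<Rightarrow> ('n \<Rightarrow> 'n \<Rightarrow> 'n times \<Rightarrow> complex \<Rightarrow> complex)
     \<Rightarrow> complex \<Rightarrow> 'n times \<Rightarrow> complex^'n^'n" where
  "psi T E z t = matrix_inv (tau_matrix T t) ** phi E z t"

text \<open>The factor \<open>chi\<close> in \<open>psi = chi ** psi0\<close>, written so that it makes sense near \<open>z = \<infinity>\<close>, where
  the series \<open>xi\<close> need not converge.\<close>

definition chi ::
  "('n::finite \<Rightarrow> 'n \<Rightarrow> 'n times \<Rightarrow> complex) \<Rightarrow> ('n \<Rightarrow> 'n \<Rightarrow> 'n times \<Rightarrow> complex \<Rightarrow> complex)
     \<Rightarrow> complex \<Rightarrow> 'n times \<Rightarrow> complex^'n^'n" where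
  "chi T E z t = matrix_inv (tau_matrix T t) ** (\<chi> i j. E i j t (1 / z))"

lemma psi_eq_chi_psi0: "psi T E z t = chi T E z t ** psi0 z t"
proof -
  have "phi E z t = (\<chi> i j. E i j t (1 / z)) ** psi0 z t"
    by (simp add: phi_def psi0_def matrix_matrix_mult_def vec_eq_iff if_distrib sum.delta
        cong: if_cong)
  then show ?thesis
    by (simp add: psi_def chi_def matrix_mul_assoc)
qed

definition beta ::
  "('n::finite \<Rightarrow> 'n \<Rightarrow> 'n times \<Rightarrow> complex) \<Rightarrow> ('n \<Rightarrow> 'n \<Rightarrow> 'n times \<Rightarrow> complex \<Rightarrow> complex)
     \<Rightarrow> 'n times \<Rightarrow> complex^'n^'n" where
  "beta T E t = (THE B. \<forall>i j.
     (\<lambda>z. chi T E z t $ i $ j - (mat 1 :: complex^'n^'n) $ i $ j - B $ i $ j / z)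
       \<in> O[at_infinity](\<lambda>z. 1 / z ^ 2))"

definition G_matrix ::
  "('n::finite \<Rightarrow> 'n \<Rightarrow> 'n times \<Rightarrow> complex) \<Rightarrow> 'n times \<Rightarrow> complex^'n^'n" where
  "G_matrix T t = matrix_inv (tau_matrix T t) ** transpose (tau_matrix T t)"

definition frame ::
  "('n::finite \<Rightarrow> 'n \<Rightarrow> 'n times \<Rightarrow> complex) \<Rightarrow> 'n \<Rightarrow> 'n times \<Rightarrow> complex^'n" where
  "frame T j t = row j (G_matrix T t)"

section \<open>Ribaucour transformation\<close>

definition has_u_derivative :: "('n times \<Rightarrow> complex) \<Rightarrow> complex \<Rightarrow> 'n \<Rightarrow> 'n times \<Rightarrow> bool" where
  "has_u_derivative f f' l t \<longleftrightarrow>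
     ((\<lambda>u. f (t(l := (t l)(0 := u)))) has_field_derivative f') (at (t l 0))"

text \<open>Orthonormality refers to the bilinear (not the Hermitian) dot product.\<close>

definition orthonormal_frame_at ::
  "('n::finite times \<Rightarrow> complex^'n^'n) \<Rightarrow> ('n \<Rightarrow> 'n times \<Rightarrow> complex^'n) \<Rightarrow> 'n times \<Rightarrow> bool" where
  "orthonormal_frame_at b g t \<longleftrightarrow>
     (\<forall>j k. (\<Sum>m\<in>UNIV. g j t $ m * g k t $ m) = (if j = k then 1 else 0)) \<and>
     (\<forall>k l m. k \<noteq> l \<longrightarrow> has_u_derivative (\<lambda>s. g k s $ m) (b t $ k $ l * g l t $ m) l t)"

definition transformation_data_at ::
  "('n::finite times \<Rightarrow> complex^'n^'n) \<Rightarrow> ('n \<Rightarrow> 'n times \<Rightarrow> complex) \<Rightarrow> 'n times \<Rightarrow> bool" where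
  "transformation_data_at b \<zeta> t \<longleftrightarrow>
     (\<forall>k l. k \<noteq> l \<longrightarrow> has_u_derivative (\<zeta> k) (b t $ k $ l * \<zeta> l t) l t)"

definition ribaucour ::
  "('n::finite \<Rightarrow> 'n times \<Rightarrow> complex) \<Rightarrow> ('n \<Rightarrow> 'n times \<Rightarrow> complex^'n)
     \<Rightarrow> 'n \<Rightarrow> 'n times \<Rightarrow> complex^'n" where
  "ribaucour \<zeta> g j t =
     g j t - (2 * \<zeta> j t / (\<Sum>k\<in>UNIV. (\<zeta> k t)\<^sup>2)) *s (\<Sum>k\<in>UNIV. \<zeta> k t *s g k t)"

end

theory Submission
  imports Defs
begin

text \<open>Write \<open>A\<close> and \<open>A'\<close> for the tau matrix at \<open>t\<close> and at \<open>t + [1/p] e_i\<close>, with columns \<open>a_k\<close>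
  and \<open>a'_k\<close>. With both times equal, the bilinear equation is \<open>A A\<^sup>T = A\<^sup>T A\<close>, so that
  \<open>G = A\<^bsup>-1\<^esup> A\<^sup>T\<close> is orthogonal. With the times \<open>t\<close> and \<open>t + [1/p] e_i\<close>, the exponential factor
  becomes \<open>(p - z) / (p + z)\<close>, and residues at \<open>\<infinity>\<close> and \<open>-p\<close> give
  \<open>A A'\<^sup>T - 2 a_i a'_i\<^sup>T + 2 a'_i a_i\<^sup>T = A\<^sup>T A'\<close>. For \<open>v = A\<^bsup>-1\<^esup> a'_i\<close>, which is proportional to \<open>\<zeta>\<close>,
  this says \<open>S G' = G - 2 v a\<^sup>T\<close> with a sign matrix \<open>S\<close> and some vector \<open>a \<noteq> 0\<close>. As \<open>G\<close> and \<open>S G'\<close>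
  are both orthogonal, \<open>b = G a\<close> satisfies \<open>v b\<^sup>T + b v\<^sup>T = 2 (b \<cdot> b) v v\<^sup>T\<close>, which forces
  \<open>b = v / (v \<cdot> v)\<close> and \<open>v \<cdot> v \<noteq> 0\<close>: this is the Ribaucour formula. The two linear systems follow by
  differentiating the same two instances of the bilinear equation with respect to \<open>u_l\<close>.

  All contour integrals are taken in the coordinate \<open>w = 1 / z\<close>, in which the extensions are
  holomorphic on the disc.\<close>

section \<open>Means over the unit circle\<close>

text \<open>On the unit circle \<open>dz / (2 pi i z)\<close> is normalised arc length. As a real
  integral over \<open>{0..1}\<close> it is easily shown to be linear, invariant under inversion and
  continuous in parameters.\<close>

definition circle_mean :: "(complex \<Rightarrow> complex) \<Rightarrow> complex" where
  "circle_mean f = integral {0..1} (\<lambda>s. f (cis (2 * pi * s)))"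

lemma contour_integral_eq_circle_mean:
  "contour_integral (circlepath 0 1) (\<lambda>z. f z / (2 * of_real pi * \<i> * z)) = circle_mean f"
proof -
  have "cis (2 * pi * s) = exp (2 * of_real pi * \<i> * of_real s)" for s
    by (simp add: cis_conv_exp mult_ac)
  then show ?thesis
    unfolding contour_integral_integral circle_mean_def
    by (intro integral_cong, subst vector_derivative_circlepath) (simp add: circlepath)
qed

lemma continuous_on_compose_cis:
  fixes f :: "complex \<Rightarrow> complex"
  assumes "continuous_on (sphere 0 1) f"
  shows "continuous_on S (\<lambda>s. f (cis (2 * pi * s)))"
  by (rule continuous_on_compose2[OF assms]) (auto intro!: continuous_intros)

lemma circle_mean_cong:
  "(\<And>z. norm z = 1 \<Longrightarrow> f z = g z) \<Longrightarrow> circle_mean f = circle_mean g"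
  unfolding circle_mean_def by (intro integral_cong) simp

lemma circle_mean_integrable:
  fixes f :: "complex \<Rightarrow> complex"
  assumes "continuous_on (sphere 0 1) f"
  shows "(\<lambda>s. f (cis (2 * pi * s))) integrable_on {0..1}"
  using integrable_continuous_interval[OF continuous_on_compose_cis[OF assms]] by simp

lemma circle_mean_diff:
  assumes "continuous_on (sphere 0 1) f" "continuous_on (sphere 0 1) g"
  shows "circle_mean (\<lambda>z. f z - g z) = circle_mean f - circle_mean g"
  unfolding circle_mean_def using assms by (intro integral_diff circle_mean_integrable)

lemma circle_mean_cmult: "circle_mean (\<lambda>z. c * f z) = c * circle_mean f"
  unfolding circle_mean_def by simp

text \<open>Inversion reverses the parametrisation, \<open>s \<mapsto> 1 - s\<close>. This carries
  integrals in \<open>z\<close> over to \<open>w = 1 / z\<close>.\<close>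

lemma circle_mean_inverse:
  assumes "continuous_on (sphere 0 1) f"
  shows "circle_mean (\<lambda>z. f (1 / z)) = circle_mean f"
proof -
  have "1 / cis (2 * pi * s) = cis (2 * pi * (1 - s))" for s
    using cis_divide[of "2 * pi" "2 * pi * s"] by (simp add: right_diff_distrib)
  then have "circle_mean (\<lambda>z. f (1 / z)) = integral {0..1} (\<lambda>s. f (cis (2 * pi * (1 - s))))"
    by (simp add: circle_mean_def)
  also have "((\<lambda>s. f (cis (2 * pi * (1 - s)))) has_integral circle_mean f) {0..1}"
    using has_integral_affinity[of "\<lambda>s. f (cis (2 * pi * s))" "circle_mean f" 0 1 "-1" 1]
      circle_mean_integrable[OF assms]
    by (simp add: circle_mean_def has_integral_integral)
  then have "integral {0..1} (\<lambda>s. f (cis (2 * pi * (1 - s)))) = circle_mean f"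
    by (rule integral_unique)
  finally show ?thesis .
qed

text \<open>The factor \<open>w\<close> cancels the \<open>1 / w\<close> of the measure, leaving
  Cauchy's integral formula at \<open>a\<close>.\<close>

lemma circle_mean_Cauchy:
  assumes "f holomorphic_on ball 0 r" "r > 1" "norm a < 1"
  shows "circle_mean (\<lambda>w. f w * (w / (w - a))) = f a"
proof -
  have "f holomorphic_on cball 0 1"
    by (rule holomorphic_on_subset[OF assms(1)]) (use assms(2) in auto)
  then have "contour_integral (circlepath 0 1) (\<lambda>w. f w / (w - a)) = 2 * of_real pi * \<i> * f a"
    using contour_integral_unique[OF Cauchy_integral_circlepath_simple, of f 0 1 a] assms(3) by simp
  moreover have "circle_mean (\<lambda>w. f w * (w / (w - a)))
      = contour_integral (circlepath 0 1) (\<lambda>w. 1 / (2 * of_real pi * \<i>) * (f w / (w - a)))"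
    unfolding contour_integral_eq_circle_mean[symmetric]
    by (rule contour_integral_cong) (auto simp: dist_norm)
  moreover have "\<dots> = 1 / (2 * of_real pi * \<i>) * contour_integral (circlepath 0 1) (\<lambda>w. f w / (w - a))"
    by (simp only: contour_integral_integral mult.assoc integral_mult_right)
  ultimately show ?thesis by simp
qed

lemma circle_mean_holomorphic:
  assumes "f holomorphic_on ball 0 r" "r > 1"
  shows "circle_mean f = f 0"
  using circle_mean_Cauchy[OF assms, of 0] circle_mean_cong[of f "\<lambda>w. f w * (w / (w - 0))"]
  by fastforce

lemma circle_mean_deriv:
  assumes "f holomorphic_on ball 0 r" "r > 1"
  shows "circle_mean (\<lambda>w. f w / w) = deriv f 0"
proof -
  have h: "f holomorphic_on cball 0 1"
    by (rule holomorphic_on_subset[OF assms(1)]) (use assms(2) in auto)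
  then have "contour_integral (circlepath 0 1) (\<lambda>w. f w / (w - 0)\<^sup>2) = 2 * of_real pi * \<i> * deriv f 0"
    using Cauchy_contour_integral_circlepath_2[OF holomorphic_on_imp_continuous_on[OF h]
        holomorphic_on_subset[OF h ball_subset_cball], of 0] by simp
  moreover have "circle_mean (\<lambda>w. f w / w)
      = contour_integral (circlepath 0 1) (\<lambda>w. 1 / (2 * of_real pi * \<i>) * (f w / (w - 0)\<^sup>2))"
    unfolding contour_integral_eq_circle_mean[symmetric]
    by (rule contour_integral_cong) (auto simp: dist_norm power2_eq_square)
  moreover have "\<dots> = 1 / (2 * of_real pi * \<i>) * contour_integral (circlepath 0 1) (\<lambda>w. f w / (w - 0)\<^sup>2)"
    by (simp only: contour_integral_integral mult.assoc integral_mult_right)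
  ultimately show ?thesis by simp
qed

lemma continuous_on_circle_mean:
  fixes f :: "complex \<Rightarrow> complex \<Rightarrow> complex"
  assumes "continuous_on (U \<times> sphere 0 1) (\<lambda>(u, w). f u w)"
  shows "continuous_on U (\<lambda>u. circle_mean (f u))"
proof -
  have "continuous_on (U \<times> cbox 0 1) (\<lambda>(u, s). f u (cis (2 * pi * s)))"
    unfolding split_beta
    by (rule continuous_on_compose2[OF assms[unfolded split_beta],
          where f = "\<lambda>x. (fst x, cis (2 * pi * snd x))", simplified])
       (auto intro!: continuous_intros)
  from integral_continuous_on_param[OF this] show ?thesis
    by (simp add: circle_mean_def)
qed

section \<open>The series \<open>xi\<close> under shifts and under changes of the first time\<close>

lemma exp_xi_bracket:
  assumes "norm (z * w) < 1"
  shows "summable (\<lambda>n. z ^ (2 * n + 1) * bracket w n)"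
    and "exp (xi z (bracket w)) = (1 + z * w) / (1 - z * w)"
proof -
  define x where "x = z * w"
  have x: "norm x < 1" "1 + x \<noteq> 0" "1 - x \<noteq> 0"
    using assms by (auto simp: x_def add_eq_0_iff)
  \<comment> \<open>The even terms of the two logarithm series cancel and the odd ones double, so
    \<open>xi z (bracket w)\<close> is \<open>ln (1 + x) - ln (1 - x)\<close>.\<close>
  have "(\<lambda>n. - ((- x) ^ n) / of_nat n - - ((- (- x)) ^ n) / of_nat n) sums (ln (1 + x) - ln (1 + - x))"
    using x(1) by (intro sums_diff Ln_series') auto
  also have "(\<lambda>n. - ((- x) ^ n) / of_nat n - - ((- (- x)) ^ n) / of_nat n)
      = (\<lambda>n. if odd n then 2 * x ^ n / of_nat n else 0)"
    by (auto simp: fun_eq_iff power_minus' add_divide_distrib[symmetric])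
  finally have "(\<lambda>n. 2 * x ^ (2 * n + 1) / of_nat (2 * n + 1)) sums (ln (1 + x) - ln (1 - x))"
    by (subst (asm) sums_mono_reindex[of "\<lambda>n. 2 * n + 1", symmetric])
       (auto simp: strict_mono_def elim!: oddE)
  moreover have "2 * x ^ (2 * n + 1) / of_nat (2 * n + 1) = z ^ (2 * n + 1) * bracket w n" for n
    by (simp add: x_def bracket_def power_mult_distrib mult_ac del: of_nat_Suc)
  ultimately have s: "(\<lambda>n. z ^ (2 * n + 1) * bracket w n) sums (ln (1 + x) - ln (1 - x))"
    by simp
  then show "summable (\<lambda>n. z ^ (2 * n + 1) * bracket w n)"
    by (rule sums_summable)
  from s have "xi z (bracket w) = ln (1 + x) - ln (1 - x)"
    unfolding xi_def by (rule sums_unique[symmetric])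
  then show "exp (xi z (bracket w)) = (1 + z * w) / (1 - z * w)"
    using x by (simp add: exp_diff exp_Ln flip: x_def)
qed

lemma xi_fun_upd_0:
  assumes "summable (\<lambda>n. z ^ (2 * n + 1) * s n)"
  shows "summable (\<lambda>n. z ^ (2 * n + 1) * (s(0 := u)) n)"
    and "xi z (s(0 := u)) = xi z s + z * (u - s 0)"
proof -
  have "(\<lambda>n. if n = 0 then z * (u - s 0) else 0) sums (z * (u - s 0))"
    using sums_single[of 0 "\<lambda>n. z * (u - s 0)"] by (simp add: eq_commute)
  then have "(\<lambda>n. z ^ (2 * n + 1) * s n + (if n = 0 then z * (u - s 0) else 0)) sums
      (xi z s + z * (u - s 0))"
    unfolding xi_def using assms by (intro sums_add summable_sums)
  also have "(\<lambda>n. z ^ (2 * n + 1) * s n + (if n = 0 then z * (u - s 0) else 0))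
      = (\<lambda>n. z ^ (2 * n + 1) * (s(0 := u)) n)"
    by (auto simp: fun_eq_iff algebra_simps)
  finally have "(\<lambda>n. z ^ (2 * n + 1) * (s(0 := u)) n) sums (xi z s + z * (u - s 0))" .
  then show "summable (\<lambda>n. z ^ (2 * n + 1) * (s(0 := u)) n)"
    and "xi z (s(0 := u)) = xi z s + z * (u - s 0)"
    unfolding xi_def by (simp_all add: sums_iff)
qed

lemma xi_converges_summable:
  assumes "xi_converges R s" "norm z \<le> R"
  shows "summable (\<lambda>n. z ^ (2 * n + 1) * s n)"
  using assms unfolding xi_converges_def
  by (auto intro: summable_norm_cancel)

section \<open>Differentiating the bilinear equation\<close>

definition u_update :: "'n \<Rightarrow> 'n times \<Rightarrow> complex \<Rightarrow> 'n times" where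
  "u_update l t u = t(l := (t l)(0 := u))"

lemma u_update_self [simp]: "u_update l t (t l 0) = t"
  by (simp add: u_update_def)

lemma u_update_in_polydisc:
  "u_update l t u' \<in> polydisc {(l, 0)} (u_update l t u) d \<longleftrightarrow> norm (u' - u) < d"
  by (auto simp: polydisc_def u_update_def)

text \<open>Turns the epsilon-delta condition over \<open>polydisc\<close>, for the single
  coordinate \<open>u_l\<close>, into a Frechet derivative in the pair \<open>(u, w)\<close>, to
  which the general calculus applies.\<close>

lemma jointly_cdifferentiable_has_derivative:
  assumes "jointly_cdifferentiable {(l, 0)} f (u_update l t u) w"
  obtains a b where "((\<lambda>x. f (u_update l t (fst x)) (snd x)) has_derivative
      (\<lambda>x. a * snd x + b * fst x)) (at (u, w))"
proof -
  have at: "u_update l t u l 0 = u" by (simp add: u_update_def)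
  obtain a b' where "\<forall>e>0. \<exists>d>0. \<forall>t'\<in>polydisc {(l, 0)} (u_update l t u) d. \<forall>w'\<in>ball w d.
        norm (f t' w' - f (u_update l t u) w
            - (a * (w' - w) + (\<Sum>(i, n)\<in>{(l, 0)}. b' i n * (t' i n - u_update l t u i n))))
          \<le> e * (norm (w' - w) + (\<Sum>(i, n)\<in>{(l, 0)}. norm (t' i n - u_update l t u i n)))"
    using assms unfolding jointly_cdifferentiable_def by (elim exE)
  moreover define b where "b = b' l 0"
  ultimately have ab: "\<And>e. e > 0 \<Longrightarrow>
      \<exists>d>0. \<forall>t'\<in>polydisc {(l, 0)} (u_update l t u) d. \<forall>w'\<in>ball w d.
        norm (f t' w' - f (u_update l t u) w - (a * (w' - w) + b * (t' l 0 - u)))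
          \<le> e * (norm (w' - w) + norm (t' l 0 - u))"
    by (simp add: at)
  have "((\<lambda>x. f (u_update l t (fst x)) (snd x)) has_derivative
      (\<lambda>x. a * snd x + b * fst x)) (at (u, w))"
    unfolding has_derivative_at_alt
  proof (intro conjI allI impI)
    show "bounded_linear (\<lambda>x. a * snd x + b * fst x)"
      by (intro bounded_linear_add bounded_linear_const_mult bounded_linear_fst bounded_linear_snd)
    fix e :: real assume "e > 0"
    \<comment> \<open>Half of \<open>e\<close>, because the condition measures displacement by the
      sum of two norms, each at most the norm of the pair.\<close>
    then obtain d where d: "d > 0" "\<And>t' w'. t' \<in> polydisc {(l, 0)} (u_update l t u) d \<Longrightarrow>
        w' \<in> ball w d \<Longrightarrow>
        norm (f t' w' - f (u_update l t u) w - (a * (w' - w) + b * (t' l 0 - u)))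
          \<le> e / 2 * (norm (w' - w) + norm (t' l 0 - u))"
      using ab[of "e / 2"] by auto
    have "norm (f (u_update l t (fst y)) (snd y) - f (u_update l t u) w
          - (a * snd (y - (u, w)) + b * fst (y - (u, w)))) \<le> e * norm (y - (u, w))"
      if y: "norm (y - (u, w)) < d" for y
    proof -
      obtain u' w' where [simp]: "y = (u', w')" by (cases y)
      have n: "norm (u' - u) \<le> norm (y - (u, w))" "norm (w' - w) \<le> norm (y - (u, w))"
        using norm_fst_le[of "u' - u" "w' - w"] norm_snd_le[of "w' - w" "u' - u"] by auto
      have "norm (f (u_update l t u') w' - f (u_update l t u) w
          - (a * (w' - w) + b * (u' - u))) \<le> e / 2 * (norm (w' - w) + norm (u' - u))"
      proof -
        have "u_update l t u' \<in> polydisc {(l, 0)} (u_update l t u) d" "w' \<in> ball w d"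
          using n y by (auto simp: u_update_in_polydisc dist_norm norm_minus_commute)
        from d(2)[OF this] show ?thesis by (simp add: u_update_def)
      qed
      also have "\<dots> \<le> e / 2 * (norm (y - (u, w)) + norm (y - (u, w)))"
        using \<open>e > 0\<close> n by (intro mult_left_mono add_mono) auto
      finally show ?thesis by simp
    qed
    with \<open>d > 0\<close> show "\<exists>d>0. \<forall>y. norm (y - (u, w)) < d \<longrightarrow>
        norm (f (u_update l t (fst y)) (snd y) - f (u_update l t (fst (u, w))) (snd (u, w))
          - (a * snd (y - (u, w)) + b * fst (y - (u, w)))) \<le> e * norm (y - (u, w))"
      by auto
  qed
  then show ?thesis by (rule that)
qed

text \<open>The difference quotient of \<open>exp\<close> at 0 with its removable singularity
  filled, hence an entire function.\<close>

definition exp_quotient :: "complex \<Rightarrow> complex" where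
  "exp_quotient x = (if x = 0 then 1 else (exp x - 1) / x)"

lemma continuous_on_exp_quotient [continuous_intros]:
  assumes "continuous_on S f"
  shows "continuous_on S (\<lambda>x. exp_quotient (f x))"
proof -
  have "(\<lambda>z::complex. if z = 0 then deriv exp 0 else (exp z - exp 0) / (z - 0)) holomorphic_on UNIV"
    by (rule pole_lemma_open) (auto intro: holomorphic_intros)
  moreover have "deriv exp (0::complex) = 1"
    using DERIV_imp_deriv[OF DERIV_exp[of "0::complex"]] by simp
  ultimately have "exp_quotient holomorphic_on UNIV"
    by (simp add: exp_quotient_def[abs_def] cong: if_cong)
  from continuous_on_compose2[OF holomorphic_on_imp_continuous_on[OF this] assms] show ?thesis
    by auto
qed

lemma exp_quotient_0 [simp]: "exp_quotient 0 = 1"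
  by (simp add: exp_quotient_def)

lemma exp_eq_exp_quotient: "exp x = 1 + x * exp_quotient x"
  by (simp add: exp_quotient_def)

section \<open>Regularity of tau functions, and the bilinear equation in the coordinate
  \<open>w = 1 / z\<close>\<close>

context bkp_tau
begin

lemma shift_in_times:
  assumes "t \<in> D" "norm p > 1"
  shows "shift i (1 / p) t \<in> D"
  using times assms unfolding suitable_times_def by blast

lemma times_summable:
  assumes "t \<in> D" "norm z \<le> 1"
  shows "summable (\<lambda>n. z ^ (2 * n + 1) * t k n)"
proof -
  have "xi_converges 1 (t k)" using times assms(1) unfolding suitable_times_def by blast
  then show ?thesis using assms(2) by (rule xi_converges_summable)
qed

lemma E_holomorphic:
  assumes "t \<in> D"
  obtains r where "r > 1" "E i j t holomorphic_on ball 0 r"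
  using extension assms unfolding tau_extension_def by blast

lemma E_0: "t \<in> D \<Longrightarrow> E i j t 0 = T i j t"
  using extension unfolding tau_extension_def by blast

text \<open>At \<open>z = - p\<close> the backward shift becomes the forward shift, since
  \<open>bracket\<close> is odd. This is why the transformation data are taken at
  \<open>- p\<close>.\<close>

lemma E_shift:
  assumes "t \<in> D" "norm p > 1"
  shows "E i j t (- (1 / p)) = T i j (shift j (1 / p) t)"
proof -
  have "E i j t (1 / (- p)) = T i j (shift j (- 1 / (- p)) t)"
    using extension assms unfolding tau_extension_def by (metis norm_minus_cancel)
  then show ?thesis by simp
qed

lemma E_continuous_sphere:
  assumes "t \<in> D"
  shows "continuous_on (sphere 0 1) (E i j t)" "continuous_on (sphere 0 1) (\<lambda>w. E i j t (- w))"
proof -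
  obtain r where r: "r > 1" "E i j t holomorphic_on ball 0 r" by (rule E_holomorphic[OF assms])
  then have *: "continuous_on (ball 0 r) (E i j t)" by (intro holomorphic_on_imp_continuous_on)
  show "continuous_on (sphere 0 1) (E i j t)"
    using r(1) by (intro continuous_on_subset[OF *]) auto
  show "continuous_on (sphere 0 1) (\<lambda>w. E i j t (- w))"
    using r(1) by (intro continuous_on_compose2[OF *]) (auto intro!: continuous_intros)
qed

lemma u_update_local:
  assumes "t \<in> D"
  obtains d r where "d > 0" "r > 1" "\<And>u. u \<in> ball (t l 0) d \<Longrightarrow> u_update l t u \<in> D"
    "\<And>u w. u \<in> ball (t l 0) d \<Longrightarrow> w \<in> ball 0 r \<Longrightarrow>
      jointly_cdifferentiable {(l, 0)} (E i j) (u_update l t u) w"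
proof -
  have mem: "u_update l t u \<in> polydisc {(l, 0)} t d" if "u \<in> ball (t l 0) d" for u d
    using that u_update_in_polydisc[of l t u "t l 0" d]
    by (simp add: dist_norm norm_minus_commute)
  obtain d1 where d1: "d1 > 0" "polydisc {(l, 0)} t d1 \<subseteq> D"
    using times assms unfolding suitable_times_def
    by (metis finite.emptyI finite.insertI)
  obtain d2 r where d2: "d2 > 0" "r > 1" "\<And>t' w. t' \<in> polydisc {(l, 0)} t d2 \<Longrightarrow> w \<in> ball 0 r \<Longrightarrow>
      jointly_cdifferentiable {(l, 0)} (E i j) t' w"
    using extension assms unfolding tau_extension_def
    by (metis finite.emptyI finite.insertI)
  show ?thesis
    by (rule that[of "min d1 d2" r]) (use d1 d2 mem in auto)
qed

text \<open>Supplies the joint continuity that parameter integrals over the circle require; as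
  \<open>r > 1\<close>, the circle lies inside the domain.\<close>

lemma E_jointly_continuous:
  assumes "t \<in> D"
  obtains d r where "d > 0" "r > 1"
    "continuous_on (ball (t l 0) d \<times> ball 0 r) (\<lambda>(u, w). E i j (u_update l t u) w)"
proof -
  obtain d r where dr: "d > 0" "r > 1"
    "\<And>u w. u \<in> ball (t l 0) d \<Longrightarrow> w \<in> ball 0 r \<Longrightarrow>
      jointly_cdifferentiable {(l, 0)} (E i j) (u_update l t u) w"
    by (rule u_update_local[OF assms, where l = l and i = i and j = j]) blast
  have "isCont (\<lambda>x. E i j (u_update l t (fst x)) (snd x)) x"
    if "x \<in> ball (t l 0) d \<times> ball 0 r" for x
    using that dr(3)[of "fst x" "snd x"]
    by (auto elim!: jointly_cdifferentiable_has_derivative intro: has_derivative_continuous)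
  then have "continuous_on (ball (t l 0) d \<times> ball 0 r) (\<lambda>(u, w). E i j (u_update l t u) w)"
    unfolding split_beta by (intro continuous_at_imp_continuous_on) auto
  with dr show ?thesis by (intro that)
qed

lemma E_u_differentiable:
  assumes "t \<in> D" "norm w \<le> 1"
  obtains e where "((\<lambda>u. E i j (u_update l t u) w) has_field_derivative e) (at (t l 0))"
proof -
  obtain d r where "d > 0" "r > 1"
    "\<And>u w. u \<in> ball (t l 0) d \<Longrightarrow> w \<in> ball 0 r \<Longrightarrow>
      jointly_cdifferentiable {(l, 0)} (E i j) (u_update l t u) w"
    by (rule u_update_local[OF assms(1), where l = l and i = i and j = j]) blast
  then have "jointly_cdifferentiable {(l, 0)} (E i j) (u_update l t (t l 0)) w"
    using assms(2) by (metis centre_in_ball mem_ball_0 order.strict_trans1)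
  then obtain a b where "((\<lambda>x. E i j (u_update l t (fst x)) (snd x)) has_derivative
      (\<lambda>x. a * snd x + b * fst x)) (at (t l 0, w))"
    by (rule jointly_cdifferentiable_has_derivative)
  moreover have "((\<lambda>u. (u, w)) has_derivative (\<lambda>u. (u, 0))) (at (t l 0))"
    by (intro has_derivative_Pair has_derivative_ident has_derivative_const)
  ultimately have "((\<lambda>u. E i j (u_update l t u) w) has_derivative (\<lambda>u. b * u)) (at (t l 0))"
    using diff_chain_at[of "\<lambda>u. (u, w)" _ "t l 0"] by (force simp: o_def)
  then show ?thesis
    by (intro that) (simp add: has_field_derivative_def)
qed

text \<open>\<open>T\<close> is the extension at \<open>w = 0\<close> for all times near
  \<open>t\<close>.\<close>

lemma T_u_differentiable:
  assumes "t \<in> D"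
  obtains e where "((\<lambda>u. T i j (u_update l t u)) has_field_derivative e) (at (t l 0))"
proof -
  obtain d where d: "d > 0" "\<And>u. u \<in> ball (t l 0) d \<Longrightarrow> u_update l t u \<in> D"
    by (rule u_update_local[OF assms, where l = l and i = i and j = j]) blast
  obtain e where "((\<lambda>u. E i j (u_update l t u) 0) has_field_derivative e) (at (t l 0))"
    by (rule E_u_differentiable[OF assms, where w = 0 and l = l and i = i and j = j]) auto
  then have "((\<lambda>u. T i j (u_update l t u)) has_field_derivative e) (at (t l 0))"
    by (rule has_field_derivative_transform_within_open[where S = "ball (t l 0) d"])
       (use d E_0 in auto)
  then show ?thesis by (rule that)
qed

text \<open>Any continuous \<open>\<kappa>\<close> with the right values on the circle may represent
  the exponential factor, so that a constant or a rational kernel can take its place.\<close>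

lemma bilinear_circle_mean:
  assumes "t \<in> D" "t' \<in> D"
    and cont: "\<And>k. continuous_on (sphere 0 1) (\<kappa> k)"
    and \<kappa>: "\<And>k w. norm w = 1 \<Longrightarrow> exp (xi (1 / w) (t k) - xi (1 / w) (t' k)) = \<kappa> k w"
  shows "(\<Sum>k\<in>UNIV. circle_mean (\<lambda>w. \<kappa> k w * E a k t w * E b k t' (- w)))
    = (\<Sum>k\<in>UNIV. T k a t * T k b t')"
proof -
  have "circle_mean (\<lambda>w. \<kappa> k w * E a k t w * E b k t' (- w))
      = contour_integral (circlepath 0 1)
         (\<lambda>z. 1 / (2 * of_real pi * \<i> * z) * exp (xi z (t k) - xi z (t' k))
               * E a k t (1 / z) * E b k t' (- 1 / z))" for k
  proof -
    have "circle_mean (\<lambda>w. \<kappa> k w * E a k t w * E b k t' (- w))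
        = circle_mean (\<lambda>z. \<kappa> k (1 / z) * E a k t (1 / z) * E b k t' (- (1 / z)))"
      by (subst circle_mean_inverse[symmetric])
         (auto intro!: continuous_intros cont E_continuous_sphere assms)
    also have "\<dots> = circle_mean (\<lambda>z. exp (xi z (t k) - xi z (t' k)) * E a k t (1 / z) * E b k t' (- 1 / z))"
      by (rule circle_mean_cong) (simp add: \<kappa>[symmetric] norm_divide)
    finally show ?thesis
      unfolding contour_integral_eq_circle_mean[symmetric] by (simp add: field_simps)
  qed
  then show ?thesis
    using bilinear[OF assms(1,2)] by simp
qed

text \<open>Only the component \<open>k = l\<close> of the integrand acquires a new factor \<open>exp (h / w)\<close> under
  \<open>u_l \<mapsto> u_l + h\<close>; splitting it as \<open>1 + (h / w) exp_quotient (h / w)\<close> replaces differentiation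
  under the integral sign by continuity of a parameter integral.\<close>

lemma bilinear_u_derivative:
  assumes "t \<in> D" "t' \<in> D"
    and cont: "\<And>k. continuous_on (sphere 0 1) (\<kappa> k)"
    and \<kappa>: "\<And>k w. norm w = 1 \<Longrightarrow> exp (xi (1 / w) (t k) - xi (1 / w) (t' k)) = \<kappa> k w"
  shows "((\<lambda>u. (\<Sum>k\<in>UNIV. T k a (u_update l t u) * T k b t')
      - (\<Sum>k\<in>UNIV. circle_mean (\<lambda>w. \<kappa> k w * E a k (u_update l t u) w * E b k t' (- w))))
    has_field_derivative circle_mean (\<lambda>w. \<kappa> l w * E a l t w * E b l t' (- w) / w)) (at (t l 0))"
proof -
  define u0 where "u0 = t l 0"
  obtain d r where d: "d > 0" "r > 1"
    and c: "continuous_on (ball u0 d \<times> ball 0 r) (\<lambda>(u, w). E a l (u_update l t u) w)"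
    unfolding u0_def by (rule E_jointly_continuous[OF assms(1)])
  obtain d' where d': "d' > 0" "\<And>u. u \<in> ball u0 d' \<Longrightarrow> u_update l t u \<in> D"
    unfolding u0_def by (rule u_update_local[OF assms(1), where l = l and i = a and j = b]) blast
  define \<delta> where "\<delta> = min d d'"
  \<comment> \<open>The function to be differentiated is \<open>(u - u0) * J u\<close> near
    \<open>u0\<close>. By Caratheodory's criterion, continuity of \<open>J\<close> gives the
    derivative \<open>J u0\<close>, where \<open>exp_quotient\<close> has the value 1.\<close>
  define J where "J u = circle_mean (\<lambda>w. exp_quotient ((u - u0) / w)
      * (\<kappa> l w * E a l (u_update l t u) w * E b l t' (- w) / w))" for u
  note [continuous_intros] = cont E_continuous_sphere[OF assms(1)] E_continuous_sphere[OF assms(2)]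
  have "continuous_on (ball u0 \<delta>) J"
    unfolding J_def
  proof (rule continuous_on_circle_mean)
    have "continuous_on (ball u0 \<delta> \<times> sphere 0 1) (\<lambda>x. E a l (u_update l t (fst x)) (snd x))"
      by (rule continuous_on_subset[OF c[unfolded split_beta]]) (use d in \<open>auto simp: \<delta>_def\<close>)
    moreover have "continuous_on (ball u0 \<delta> \<times> sphere 0 1) (\<lambda>x. \<kappa> l (snd x))"
      by (rule continuous_on_compose2[OF cont]) (auto intro!: continuous_intros)
    moreover have "continuous_on (ball u0 \<delta> \<times> sphere 0 1) (\<lambda>x. E b l t' (- snd x))"
      by (rule continuous_on_compose2[OF E_continuous_sphere(2)[OF assms(2)]])
         (auto intro!: continuous_intros)
    ultimately show "continuous_on (ball u0 \<delta> \<times> sphere 0 1) (\<lambda>(u, w). exp_quotient ((u - u0) / w)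
        * (\<kappa> l w * E a l (u_update l t u) w * E b l t' (- w) / w))"
      unfolding split_beta by (intro continuous_intros) auto
  qed
  then have "isCont J u0"
    using d d' by (simp add: continuous_on_eq_continuous_at \<delta>_def)
  then have der: "((\<lambda>u. (u - u0) * J u) has_field_derivative J u0) (at u0)"
    unfolding CARAT_DERIV by (intro exI[of _ J]) (simp add: mult.commute)
  have eq: "(u - u0) * J u = (\<Sum>k\<in>UNIV. T k a (u_update l t u) * T k b t')
      - (\<Sum>k\<in>UNIV. circle_mean (\<lambda>w. \<kappa> k w * E a k (u_update l t u) w * E b k t' (- w)))"
    if u: "u \<in> ball u0 \<delta>" for u
  proof -
    define s where "s = u_update l t u"
    have s: "s \<in> D" using d' u by (auto simp: s_def \<delta>_def)
    note [continuous_intros] = E_continuous_sphere[OF s]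
    define \<mu> where "\<mu> k w = (if k = l then exp ((u - u0) / w) else 1)" for k :: 'n and w
    have c\<mu>: "continuous_on (sphere 0 1) (\<mu> k)" for k
      by (cases "k = l") (auto simp: \<mu>_def[abs_def] intro!: continuous_intros)
    have "xi (1 / w) (s k) = xi (1 / w) (t k) + (if k = l then (u - u0) / w else 0)"
      if "norm w = 1" for k w
      using xi_fun_upd_0(2)[OF times_summable[OF assms(1)], of "1 / w" l u] that
      by (simp add: s_def u_update_def u0_def norm_divide)
    then have "exp (xi (1 / w) (s k) - xi (1 / w) (t' k)) = \<mu> k w * \<kappa> k w" if "norm w = 1" for k w
      using that by (auto simp: \<mu>_def exp_add exp_diff simp flip: \<kappa>[OF that])
    then have "(\<Sum>k\<in>UNIV. T k a s * T k b t')
        = (\<Sum>k\<in>UNIV. circle_mean (\<lambda>w. \<mu> k w * \<kappa> k w * E a k s w * E b k t' (- w)))"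
      by (intro bilinear_circle_mean[symmetric] s assms(2)) (auto intro!: continuous_intros c\<mu>)
    then have "(\<Sum>k\<in>UNIV. T k a s * T k b t')
          - (\<Sum>k\<in>UNIV. circle_mean (\<lambda>w. \<kappa> k w * E a k s w * E b k t' (- w)))
        = (\<Sum>k\<in>UNIV. circle_mean (\<lambda>w. \<mu> k w * \<kappa> k w * E a k s w * E b k t' (- w))
            - circle_mean (\<lambda>w. \<kappa> k w * E a k s w * E b k t' (- w)))"
      by (simp add: sum_subtractf)
    also have "\<dots> = (\<Sum>k\<in>UNIV. if k = l then (u - u0) * J u else 0)"
    proof (rule sum.cong[OF refl])
      fix k :: 'n
      have "circle_mean (\<lambda>w. exp ((u - u0) / w) * \<kappa> l w * E a l s w * E b l t' (- w))
          - circle_mean (\<lambda>w. \<kappa> l w * E a l s w * E b l t' (- w))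
        = circle_mean (\<lambda>w. exp ((u - u0) / w) * \<kappa> l w * E a l s w * E b l t' (- w)
            - \<kappa> l w * E a l s w * E b l t' (- w))"
        by (intro circle_mean_diff[symmetric] continuous_intros) auto
      also have "\<dots> = circle_mean (\<lambda>w. (u - u0) * (exp_quotient ((u - u0) / w)
          * (\<kappa> l w * E a l s w * E b l t' (- w) / w)))"
        unfolding exp_eq_exp_quotient by (simp add: algebra_simps)
      also have "\<dots> = (u - u0) * J u"
        unfolding J_def s_def by (rule circle_mean_cmult)
      finally show "circle_mean (\<lambda>w. \<mu> k w * \<kappa> k w * E a k s w * E b k t' (- w))
            - circle_mean (\<lambda>w. \<kappa> k w * E a k s w * E b k t' (- w))
          = (if k = l then (u - u0) * J u else 0)"
        by (simp add: \<mu>_def)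
    qed
    finally show ?thesis by (simp add: s_def)
  qed
  from der have "((\<lambda>u. (\<Sum>k\<in>UNIV. T k a (u_update l t u) * T k b t')
      - (\<Sum>k\<in>UNIV. circle_mean (\<lambda>w. \<kappa> k w * E a k (u_update l t u) w * E b k t' (- w))))
    has_field_derivative J u0) (at u0)"
    by (rule has_field_derivative_transform_within_open[where S = "ball u0 \<delta>"])
       (use d d' eq in \<open>auto simp: \<delta>_def\<close>)
  then show ?thesis
    by (simp add: J_def u0_def)
qed

end

section \<open>Matrix identities behind the reflection\<close>

definition outer :: "'a::comm_ring_1^'n \<Rightarrow> 'a^'m \<Rightarrow> 'a^'m^'n" where
  "outer x y = (\<chi> a b. x $ a * y $ b)"

text \<open>There is no conjugation, as in the orthonormality of the frame; nonzero complex vectors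
  can therefore be isotropic.\<close>

definition dot :: "'a::comm_ring_1^'n \<Rightarrow> 'a^'n \<Rightarrow> 'a" where
  "dot x y = (\<Sum>a\<in>UNIV. x $ a * y $ a)"

lemma dot_commute: "dot x y = dot y x"
  by (simp add: dot_def mult.commute)

lemma dot_diff: "dot (x - y) z = dot x z - dot y z" "dot z (x - y) = dot z x - dot z y"
  by (simp_all add: dot_def algebra_simps sum_subtractf)

lemma dot_scalar: "dot (c *s x) y = c * dot x y" "dot x (c *s y) = c * dot x y"
  by (simp_all add: dot_def sum_distrib_left mult_ac)

lemma vector_outer: "x v* outer y z = dot x y *s z"
  by (simp add: vec_eq_iff vector_matrix_mult_def outer_def dot_def sum_distrib_left mult_ac)

lemma matrix_outer: "A ** outer x y = outer (A *v x) y"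
  by (simp add: vec_eq_iff matrix_matrix_mult_def matrix_vector_mult_def outer_def
      sum_distrib_left mult_ac)

lemma outer_matrix: "outer x y ** A = outer x (y v* A)"
  by (simp add: vec_eq_iff matrix_matrix_mult_def vector_matrix_mult_def outer_def
      sum_distrib_left mult_ac)

lemma row_outer: "row j (outer x y) = x $ j *s y"
  by (simp add: vec_eq_iff row_def outer_def)

lemma row_matrix_mult: "row k (A ** B) = row k A v* B"
  by (simp add: vec_eq_iff row_def matrix_matrix_mult_def vector_matrix_mult_def mult.commute)

lemma row_vector_matrix_component: "(row k A v* B) $ l = (A ** B) $ k $ l"
  unfolding row_matrix_mult[symmetric] by (simp add: row_def)

lemma row_transpose_mult: "row k (transpose A ** B) = column k A v* B"
  by (simp add: row_matrix_mult row_transpose)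

lemma row_add: "row k (A + B) = row k A + row k B"
  and row_diff: "row k (A - B) = row k A - row k B"
  by (simp_all add: vec_eq_iff row_def)

lemma dot_row: "dot (row k A) x = (A *v x) $ k"
  by (simp add: dot_def row_def matrix_vector_mult_def)

lemma dot_rows: "dot (row j A) (row k A) = (A ** transpose A) $ j $ k"
  by (simp add: dot_def row_def matrix_matrix_mult_def transpose_def)

lemma dot_vector_matrix: "dot (x v* A) y = dot x (A *v y)"
proof -
  have "dot (x v* A) y = (\<Sum>b\<in>UNIV. \<Sum>a\<in>UNIV. x $ a * A $ a $ b * y $ b)"
    by (simp add: dot_def vector_matrix_mult_def sum_distrib_left mult_ac)
  also have "\<dots> = (\<Sum>a\<in>UNIV. \<Sum>b\<in>UNIV. x $ a * A $ a $ b * y $ b)"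
    by (rule sum.swap)
  finally show ?thesis
    by (simp add: dot_def matrix_vector_mult_def sum_distrib_left mult_ac)
qed

lemma dot_column: "dot x (column l A) = (x v* A) $ l"
  by (simp add: dot_def column_def vector_matrix_mult_def mult.commute)

lemma matrix_vector_mult_column: "A *v column l B = column l (A ** B)"
  by (simp add: vec_eq_iff column_def matrix_matrix_mult_def matrix_vector_mult_def)

lemma matrix_vector_column_component: "(A *v column l B) $ k = (A ** B) $ k $ l"
  unfolding matrix_vector_mult_column by (simp add: column_def)

lemma matrix_diff_ldistrib: "A ** (B - C) = A ** B - A ** C" for A :: "'a::comm_ring_1^'n^'m"
  by (simp add: vec_eq_iff matrix_matrix_mult_def algebra_simps sum_subtractf)

lemma matrix_diff_rdistrib: "(B - C) ** A = B ** A - C ** A" for A :: "'a::comm_ring_1^'n^'m"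
  by (simp add: vec_eq_iff matrix_matrix_mult_def algebra_simps sum_subtractf)

lemma matrix_inv_inverse:
  assumes "invertible A"
  shows "A ** matrix_inv A = mat 1" "matrix_inv A ** A = mat 1"
  using someI_ex[of "\<lambda>A'. A ** A' = mat 1 \<and> A' ** A = mat 1"] assms
  unfolding invertible_def matrix_inv_def by auto

lemma column_nonzero:
  fixes A :: "'a::field^'n^'n"
  assumes "P ** A = mat 1"
  shows "column i A \<noteq> 0"
proof
  assume "column i A = 0"
  then have "column i (P ** A) = 0"
    by (simp flip: matrix_vector_mult_column)
  then have "column i (mat 1 :: 'a^'n^'n) $ i = 0"
    using assms by simp
  then show False by (simp add: column_def mat_def)
qed

text \<open>The algebraic content of the bilinear equation at equal times: \<open>A\<close> stands
  for the tau matrix and \<open>P\<close> for its inverse.\<close>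

locale commuting_transpose =
  fixes A P :: "complex^'n^'n"
  assumes inv: "A ** P = mat 1" "P ** A = mat 1"
    and comm: "A ** transpose A = transpose A ** A"
begin

abbreviation "G \<equiv> P ** transpose A"

text \<open>The commutation relation lets the factors of \<open>G\<close> change places; in this
  order, row \<open>k\<close> of \<open>G\<close> is column \<open>k\<close> of \<open>A\<close>
  multiplied by \<open>P\<close>.\<close>

lemma G_alt: "G = transpose A ** P"
proof -
  have "G = P ** (transpose A ** A) ** P"
    using inv by (simp flip: matrix_mul_assoc)
  also have "\<dots> = transpose A ** P"
    using inv by (simp add: comm[symmetric] matrix_mul_assoc)
  finally show ?thesis .
qed

lemma G_orthogonal: "G ** transpose G = mat 1"
proof -
  have "G ** transpose G = P ** (transpose A ** A) ** transpose P"
    by (simp add: matrix_transpose_mul matrix_mul_assoc)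
  also have "\<dots> = transpose A ** transpose P"
    using inv by (simp add: comm[symmetric] matrix_mul_assoc)
  finally show ?thesis by (simp add: inv flip: matrix_transpose_mul)
qed

lemma row_P_A: "row k P v* A = axis k 1"
  unfolding row_matrix_mult[symmetric] inv by (auto simp: vec_eq_iff row_def mat_def axis_def)

text \<open>Multiplication by row \<open>k\<close> of \<open>P\<close> annihilates column \<open>l\<close> of \<open>A\<close> for \<open>k \<noteq> l\<close>, so only the first
  rank one term contributes.\<close>

lemma G_row_derivative:
  assumes d: "transpose dA ** A - dA ** transpose A
      = outer (column l B) (column l A) - outer (column l A) (column l B)"
    and "k \<noteq> l"
  shows "row k (P ** (transpose dA - dA ** G)) = (P ** B) $ k $ l *s row l G"
proof -
  \<comment> \<open>If \<open>dA\<close> is the derivative of \<open>A\<close>, then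
    \<open>P ** (transpose dA - dA ** G)\<close> is that of \<open>G\<close>. Inserting
    \<open>A ** P\<close> shows that the second factor is the left side of \<open>d\<close> times
    \<open>P\<close>.\<close>
  have "transpose dA = transpose dA ** A ** P"
    using inv by (simp flip: matrix_mul_assoc)
  moreover have "dA ** G = dA ** transpose A ** P"
    by (simp add: G_alt matrix_mul_assoc)
  ultimately have "transpose dA - dA ** G = (outer (column l B) (column l A)
      - outer (column l A) (column l B)) ** P"
    by (simp add: d[symmetric] matrix_diff_rdistrib)
  also have "\<dots> = outer (column l B) (row l G) - outer (column l A) (column l B v* P)"
    by (simp add: matrix_diff_rdistrib outer_matrix G_alt row_transpose_mult)
  finally show ?thesis
    using \<open>k \<noteq> l\<close>
    by (simp add: row_matrix_mult[of k P] vector_matrix_mult_diff_rdistrib vector_outer dot_column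
        row_P_A axis_def row_vector_matrix_component)
qed

end

text \<open>The algebraic content of the bilinear equation at the times \<open>t\<close> and
  \<open>t + [1/p] e_i\<close>, the latter primed. The two rank one terms are the residue
  corrections of component \<open>i\<close>.\<close>

locale bilinear_shift =
  t: commuting_transpose A P + t': commuting_transpose A' P'
  for A P A' P' :: "complex^'n^'n" +
  fixes i :: 'n
  assumes shift: "A ** transpose A' - outer (2 *s column i A) (column i A')
      + outer (2 *s column i A') (column i A) = transpose A ** A'"
begin

text \<open>For the tau matrices, \<open>exp (xi (- p) (t i)) *s v\<close> is column
  \<open>i\<close> of the Baker matrix at \<open>- p\<close>.\<close>

definition v :: "complex^'n" where "v = P *v column i A'"

text \<open>This is \<open>shift\<close> multiplied by \<open>P\<close>. Subtracting twice the axis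
  term negates row \<open>i\<close> of \<open>transpose A'\<close>; this is the origin of the sign
  in the theorem.\<close>

lemma G_A': "t.G ** A' = transpose A' - outer (2 *s axis i 1) (column i A') + outer (2 *s v) (column i A)"
proof -
  have "P *v column i A = axis i 1"
    unfolding matrix_vector_mult_column t.inv
    by (auto simp: vec_eq_iff column_def mat_def axis_def)
  moreover have "t.G ** A' = P ** (A ** transpose A' - outer (2 *s column i A) (column i A')
      + outer (2 *s column i A') (column i A))"
    by (simp add: shift matrix_mul_assoc)
  ultimately show ?thesis
    using t.inv
    by (simp add: matrix_add_ldistrib matrix_diff_ldistrib matrix_mul_assoc matrix_outer
        vector_scalar_commute v_def)
qed

lemma row_G_A': "row l t.G v* A' = (if l = i then -1 else 1) *s column l A' + (2 * v $ l) *s column i A"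
  using arg_cong[OF G_A', of "row l"]
  by (auto simp: row_matrix_mult row_add row_diff row_outer axis_def row_transpose vec_eq_iff)

text \<open>Here \<open>d\<close> and \<open>d'\<close> are the \<open>u_l\<close>-derivatives of
  the equal-time and the shifted equation with the second time fixed, and \<open>dE\<close> is that
  of the moving vector whose value is column \<open>i\<close> of \<open>A'\<close>. The left side of
  the conclusion is then the derivative of \<open>v $ k\<close>. The term \<open>p * v $ k\<close>
  for \<open>l = i\<close> will be cancelled by the exponential in \<open>psi\<close>.\<close>

lemma wave_derivative:
  assumes d: "transpose dA ** A - dA ** transpose A
      = outer (column l B) (column l A) - outer (column l A) (column l B)"
    and d': "transpose dA ** A' - (dA ** transpose A' - outer (2 *s column i dA) (column i A')
        + outer (2 *s dE) (column i A))
      = outer ((if l = i then -1 else 1) *s column l B) (column l A') + outer (column l A) y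
        - outer ((if l = i then 2 * p else 0) *s column i A') (column i A)"
    and "k \<noteq> l"
  shows "(P *v (dE - dA *v v)) $ k = (P ** B) $ k $ l * v $ l + (if l = i then p else 0) * v $ k"
proof -
  define r where "r = row k P"
  define \<beta> where "\<beta> = (P ** B) $ k $ l"
  define c where "c = column i A"
  have rB: "dot r (column l B) = \<beta>" and rA: "dot r (column l A) = 0"
    and rv: "dot r (column i A') = v $ k"
    using \<open>k \<noteq> l\<close> unfolding r_def dot_column
    by (simp_all add: t.row_P_A axis_def \<beta>_def v_def row_vector_matrix_component
        matrix_vector_column_component)
  \<comment> \<open>This trades \<open>transpose dA\<close> for \<open>dA ** G\<close>, whose
    product with \<open>A'\<close> is known from \<open>G_A'\<close>.\<close>
  have "r v* transpose dA = (r v* dA) v* t.G + \<beta> *s row l t.G"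
    using t.G_row_derivative[OF d \<open>k \<noteq> l\<close>]
    by (simp add: row_matrix_mult vector_matrix_mult_diff_rdistrib vector_matrix_mul_assoc
        r_def \<beta>_def algebra_simps)
  then have "r v* (transpose dA ** A') = (r v* dA) v* (t.G ** A') + \<beta> *s (row l t.G v* A')"
    by (simp add: vector_matrix_left_distrib scalar_vector_matrix_assoc flip: vector_matrix_mul_assoc)
  also have "\<dots> = (r v* dA) v* transpose A' - (2 * (r v* dA) $ i) *s column i A'
      + (2 * dot r (dA *v v)) *s c
      + \<beta> *s ((if l = i then -1 else 1) *s column l A' + (2 * v $ l) *s c)"
    unfolding G_A' row_G_A' c_def
    by (simp add: vector_matrix_mult_add_rdistrib vector_matrix_mult_diff_rdistrib vector_outer
        dot_scalar dot_vector_matrix[of r dA v, symmetric])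
       (simp add: dot_def axis_def if_distrib cong: if_cong)
  finally have 1: "r v* (transpose dA ** A') = \<dots>" .
  \<comment> \<open>Row \<open>k\<close> of \<open>P\<close> is orthogonal to column
    \<open>l\<close> of \<open>A\<close>, so \<open>y\<close> drops out of
    \<open>d'\<close>.\<close>
  have "r v* (transpose dA ** A') - (r v* (dA ** transpose A')
        - (2 * dot r (column i dA)) *s column i A' + (2 * dot r dE) *s c)
      = ((if l = i then -1 else 1) * \<beta>) *s column l A' - ((if l = i then 2 * p else 0) * v $ k) *s c"
    using arg_cong[OF d', of "\<lambda>X. r v* X"]
    by (simp add: vector_matrix_mult_add_rdistrib vector_matrix_mult_diff_rdistrib vector_outer
        dot_scalar rA rB rv c_def)
  \<comment> \<open>The terms with \<open>transpose A'\<close> and with columns \<open>i\<close> and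
    \<open>l\<close> of \<open>A'\<close> agree in both expressions; only multiples of
    \<open>c\<close> remain.\<close>
  then have "(2 * (dot r (dA *v v) + \<beta> * v $ l - dot r dE) + (if l = i then 2 * p else 0) * v $ k) *s c = 0"
    unfolding 1 dot_column vector_matrix_mul_assoc[of r dA "transpose A'"] by (simp add: vec_eq_iff algebra_simps)
  moreover have "c \<noteq> 0"
    unfolding c_def by (rule column_nonzero[OF t.inv(2)])
  ultimately have "2 * (dot r (dA *v v) + \<beta> * v $ l - dot r dE) + (if l = i then 2 * p else 0) * v $ k = 0"
    unfolding vector_mul_eq_0 by blast
  then have "2 * (dot r dE - dot r (dA *v v)) = 2 * (\<beta> * v $ l + (if l = i then p else 0) * v $ k)"
    by (cases "l = i") (simp_all add: algebra_simps)
  then have "dot r dE - dot r (dA *v v) = \<beta> * v $ l + (if l = i then p else 0) * v $ k"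
    unfolding mult_cancel_left by simp
  then show ?thesis
    by (simp add: r_def \<beta>_def dot_row matrix_vector_mult_diff_distrib)
qed

lemma reflection:
  shows "dot v v \<noteq> 0"
    and "row j t.G - (2 * v $ j / dot v v) *s (\<Sum>k\<in>UNIV. v $ k *s row k t.G)
      = (- 1) ^ of_bool (i = j) *s row j t'.G"
proof -
  define a where "a = column i A v* P'"
  define \<alpha> where "\<alpha> = dot a a"
  have row_t': "row j t'.G = column j A' v* P'" for j
    unfolding t'.G_alt by (rule row_transpose_mult)
  \<comment> \<open>Multiplying \<open>row_G_A'\<close> by \<open>P'\<close> shows that the two
    frames differ by a sign in row \<open>i\<close> and the rank one matrix
    \<open>outer (2 *s v) a\<close>.\<close>
  have "row j t.G = (row j t.G v* A') v* P'" for j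
    using t'.inv by (simp add: vector_matrix_mul_assoc)
  then have "row j t.G = (if j = i then -1 else 1) *s row j t'.G + (2 * v $ j) *s a" for j
    by (simp only: row_G_A' vector_matrix_left_distrib scalar_vector_matrix_assoc row_t' a_def)
  then have G': "(if j = i then -1 else 1) *s row j t'.G = row j t.G - (2 * v $ j) *s a" for j
    by simp
  have dot_a: "dot a (row k t.G) = (t.G *v a) $ k" for k
    by (simp add: dot_commute[of a] dot_row)
  \<comment> \<open>Compares the products of rows in the two orthonormal frames; the Kronecker
    deltas cancel.\<close>
  have quad: "v $ k * (t.G *v a) $ j + v $ j * (t.G *v a) $ k = 2 * v $ j * v $ k * \<alpha>" for j k
  proof -
    have "dot ((if j = i then -1 else 1) *s row j t'.G) ((if k = i then -1 else 1) *s row k t'.G)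
        = (if j = k then 1 else 0)"
      by (auto simp: dot_scalar dot_rows t'.G_orthogonal mat_def)
    moreover have "dot (row j t.G - (2 * v $ j) *s a) (row k t.G - (2 * v $ k) *s a)
        = (if j = k then 1 else 0) - 2 * v $ k * (t.G *v a) $ j - 2 * v $ j * (t.G *v a) $ k
          + 4 * v $ j * v $ k * \<alpha>"
      unfolding dot_diff dot_scalar dot_a dot_row[of j] dot_rows t.G_orthogonal mat_def \<alpha>_def
      by (simp add: algebra_simps)
    ultimately have "2 * (v $ k * (t.G *v a) $ j + v $ j * (t.G *v a) $ k) = 2 * (2 * v $ j * v $ k * \<alpha>)"
      unfolding G' by (simp add: algebra_simps)
    then show ?thesis
      unfolding mult_cancel_left by simp
  qed
  have "A *v v = column i A'"
    using t.inv by (simp add: v_def matrix_vector_mul_assoc)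
  then have "v \<noteq> 0"
    using column_nonzero[OF t'.inv(2), of i] by auto
  then obtain m where m: "v $ m \<noteq> 0"
    by (auto simp: vec_eq_iff)
  \<comment> \<open>The diagonal case at an index with \<open>v $ m \<noteq> 0\<close> fixes one
    entry of \<open>t.G *v a\<close>; the pairs \<open>m, j\<close> then fix all others.\<close>
  have m': "(t.G *v a) $ m = v $ m * \<alpha>"
    using quad[of m m] m by simp
  have "(t.G *v a) $ j = v $ j * \<alpha>" for j
    using quad[of m j] m unfolding m' by (simp add: algebra_simps)
  then have Ga: "t.G *v a = \<alpha> *s v"
    by (simp add: vec_eq_iff mult.commute)
  \<comment> \<open>Orthogonality allows solving \<open>t.G *v a = \<alpha> *s v\<close> for
    \<open>a\<close>.\<close>
  have "transpose t.G ** t.G = mat 1"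
    using t.G_orthogonal matrix_left_right_inverse[of t.G "transpose t.G"] by simp
  then have "a = transpose t.G *v (t.G *v a)"
    by (simp add: matrix_vector_mul_assoc del: transpose_matrix_vector)
  also have "\<dots> = \<alpha> *s (v v* t.G)"
    by (simp add: Ga scalar_vector_matrix_assoc)
  finally have a: "a = \<alpha> *s (v v* t.G)" .
  have "a v* A' = column i A"
    using t'.inv by (simp add: a_def vector_matrix_mul_assoc)
  then have "a \<noteq> 0"
    using column_nonzero[OF t.inv(2), of i] by auto
  \<comment> \<open>Possible isotropy is excluded here: the nonzero vector \<open>a\<close> is
    itself a multiple by \<open>\<alpha>\<close>.\<close>
  then have "\<alpha> \<noteq> 0"
    using a by auto
  moreover have "\<alpha> = \<alpha> * (\<alpha> * dot v v)"
  proof -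
    have "\<alpha> = dot (\<alpha> *s (v v* t.G)) a"
      using arg_cong[OF a, of "\<lambda>x. dot x a"] by (simp only: flip: \<alpha>_def)
    then show ?thesis
      by (simp add: dot_scalar dot_vector_matrix Ga)
  qed
  ultimately have \<alpha>: "\<alpha> * dot v v = 1"
    by simp
  then show vv: "dot v v \<noteq> 0"
    by auto
  have "(\<Sum>k\<in>UNIV. v $ k *s row k t.G) = v v* t.G"
    by (simp add: vec_eq_iff row_def vector_matrix_mult_def mult.commute)
  then have "(2 * v $ j / dot v v) *s (\<Sum>k\<in>UNIV. v $ k *s row k t.G) = (2 * v $ j) *s a"
    using \<alpha> vv by (subst a) (simp add: field_simps)
  then show "row j t.G - (2 * v $ j / dot v v) *s (\<Sum>k\<in>UNIV. v $ k *s row k t.G)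
      = (- 1) ^ of_bool (i = j) *s row j t'.G"
    using G'[of j] by auto
qed

end

section \<open>Residues and the matrix \<open>beta\<close>\<close>

lemma field_differentiable_prod:
  fixes f :: "'i \<Rightarrow> 'a::real_normed_field \<Rightarrow> 'a"
  assumes "finite I" "\<And>i. i \<in> I \<Longrightarrow> f i field_differentiable at z within S"
  shows "(\<lambda>x. \<Prod>i\<in>I. f i x) field_differentiable at z within S"
  using assms by (induction I rule: finite_induct)
    (auto intro: field_differentiable_mult field_differentiable_const)

lemma field_differentiable_det:
  fixes A :: "'a::real_normed_field \<Rightarrow> 'a^'n^'n"
  assumes "\<And>a b. (\<lambda>u. A u $ a $ b) field_differentiable at z within S"
  shows "(\<lambda>u. det (A u)) field_differentiable at z within S"
  unfolding det_def
  by (intro field_differentiable_sum field_differentiable_mult field_differentiable_const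
      field_differentiable_prod assms finite)

text \<open>Near \<open>x\<close> the determinant is nonzero and Cramer's rule gives
  differentiability of the solution \<open>X\<close>; its derivative follows by differentiating
  \<open>A u *v X u = y u\<close>.\<close>

lemma matrix_inv_mult_derivative:
  fixes A :: "complex \<Rightarrow> complex^'n^'n" and y :: "complex \<Rightarrow> complex^'n"
    and dA :: "complex^'n^'n" and dy :: "complex^'n"
  assumes A: "\<And>a b. ((\<lambda>u. A u $ a $ b) has_field_derivative dA $ a $ b) (at x)"
    and y: "\<And>a. ((\<lambda>u. y u $ a) has_field_derivative dy $ a) (at x)"
    and inv: "invertible (A x)"
  shows "((\<lambda>u. (matrix_inv (A u) *v y u) $ k) has_field_derivative
    (matrix_inv (A x) *v (dy - dA *v (matrix_inv (A x) *v y x))) $ k) (at x)"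
proof -
  define X where "X u = matrix_inv (A u) *v y u" for u
  have dA: "(\<lambda>u. A u $ a $ b) field_differentiable at x" for a b
    using A field_differentiable_def by blast
  have ddet: "(\<lambda>u. det (A u)) field_differentiable at x"
    by (intro field_differentiable_det dA)
  have "\<forall>\<^sub>F u in nhds x. det (A u) \<noteq> 0"
    using ddet[THEN field_differentiable_imp_continuous_at] inv
    by (intro tendsto_imp_eventually_ne) (auto simp: isCont_def invertible_det_nz tendsto_at_iff_tendsto_nhds[of "\<lambda>u. det (A u)"])
  then obtain S where S: "open S" "x \<in> S" "\<And>u. u \<in> S \<Longrightarrow> det (A u) \<noteq> 0"
    unfolding eventually_nhds by blast
  have AX: "A u *v X u = y u" if "u \<in> S" for u
    using matrix_inv_inverse(1)[of "A u"] S(3)[OF that]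
    by (simp add: X_def matrix_vector_mul_assoc invertible_det_nz)
  have "(\<lambda>u. X u $ b) field_differentiable at x" for b
  proof -
    have "(\<lambda>u. det (\<chi> i j. if j = b then y u $ i else A u $ i $ j) / det (A u)) field_differentiable at x"
    proof (intro field_differentiable_divide field_differentiable_det)
      show "(\<lambda>u. (\<chi> i j. if j = b then y u $ i else A u $ i $ j) $ c $ d) field_differentiable at x" for c d
        using dA y field_differentiable_def by (cases "d = b") (auto, blast)
    qed (use dA ddet inv in \<open>auto simp: invertible_det_nz\<close>)
    then obtain D where "((\<lambda>u. det (\<chi> i j. if j = b then y u $ i else A u $ i $ j) / det (A u))
        has_field_derivative D) (at x)"
      unfolding field_differentiable_def by blast
    then have "((\<lambda>u. X u $ b) has_field_derivative D) (at x)"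
    proof (rule has_field_derivative_transform_within_open[OF _ S(1,2)])
      show "det (\<chi> i j. if j = b then y u $ i else A u $ i $ j) / det (A u) = X u $ b" if "u \<in> S" for u
        using cramer[OF S(3)[OF that], of "X u" "y u"] AX[OF that] by simp
    qed
    then show ?thesis
      using field_differentiable_def by blast
  qed
  then obtain D where D: "\<And>b. ((\<lambda>u. X u $ b) has_field_derivative D b) (at x)"
    unfolding field_differentiable_def by metis
  have "dA *v X x + A x *v (\<chi> b. D b) = dy"
  proof (simp add: vec_eq_iff, intro allI)
    fix a
    have "((\<lambda>u. \<Sum>b\<in>UNIV. A u $ a $ b * X u $ b) has_field_derivative
        (\<Sum>b\<in>UNIV. dA $ a $ b * X x $ b + D b * A x $ a $ b)) (at x)"
      by (intro DERIV_sum DERIV_mult A D)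
    moreover have "((\<lambda>u. \<Sum>b\<in>UNIV. A u $ a $ b * X u $ b) has_field_derivative dy $ a) (at x)"
    proof (rule has_field_derivative_transform_within_open[OF y S(1,2)])
      show "y u $ a = (\<Sum>b\<in>UNIV. A u $ a $ b * X u $ b)" if "u \<in> S" for u
        using AX[OF that] by (simp add: vec_eq_iff matrix_vector_mult_def)
    qed
    ultimately show "(dA *v X x) $ a + (A x *v (\<chi> b. D b)) $ a = dy $ a"
      using DERIV_unique by (fastforce simp: matrix_vector_mult_def sum.distrib mult.commute)
  qed
  then have "A x *v (\<chi> b. D b) = dy - dA *v X x"
    by (simp add: algebra_simps)
  then have "matrix_inv (A x) *v (A x *v (\<chi> b. D b)) = matrix_inv (A x) *v (dy - dA *v X x)"
    by simp
  then have "(\<chi> b. D b) = matrix_inv (A x) *v (dy - dA *v X x)"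
    by (simp add: matrix_vector_mul_assoc matrix_inv_inverse[OF inv])
  then have "D k = (matrix_inv (A x) *v (dy - dA *v X x)) $ k"
    by (simp add: vec_eq_iff)
  with D[of k] show ?thesis
    by (simp add: X_def)
qed

section \<open>Expansions at infinity\<close>

lemma holomorphic_expansion_at_infinity:
  assumes "f holomorphic_on ball 0 r" "r > 0"
  shows "(\<lambda>z. f (1 / z) - f 0 - deriv f 0 / z) \<in> O[at_infinity](\<lambda>z. 1 / z ^ 2)"
proof -
  \<comment> \<open>Two successive filled difference quotients give
    \<open>f w = f 0 + deriv f 0 * w + w ^ 2 * h w\<close> with \<open>h\<close> continuous at
    0.\<close>
  define g where "g w = (if w = 0 then deriv f 0 else (f w - f 0) / (w - 0))" for w
  define h where "h w = (if w = 0 then deriv g 0 else (g w - g 0) / (w - 0))" for w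
  have "g holomorphic_on ball 0 r"
    unfolding g_def[abs_def] by (rule pole_lemma_open[OF assms(1)]) simp
  then have "h holomorphic_on ball 0 r"
    unfolding h_def[abs_def] by (rule pole_lemma_open) simp
  then have "isCont h 0"
    using assms(2) holomorphic_on_imp_continuous_on continuous_on_eq_continuous_at[OF open_ball]
    by (metis centre_in_ball)
  then have lim: "((\<lambda>z. h (1 / z)) \<longlongrightarrow> h 0) at_infinity"
    by (rule isCont_tendsto_compose) (auto simp: divide_inverse intro: tendsto_inverse_0)
  have nz: "\<forall>\<^sub>F z in at_infinity. z \<noteq> (0::complex)"
    by (rule eventually_at_infinityI[of 1]) auto
  show ?thesis
  proof (rule bigoI_tendsto[OF Lim_transform_eventually[OF lim]])
    show "\<forall>\<^sub>F z in at_infinity. h (1 / z) = (f (1 / z) - f 0 - deriv f 0 / z) / (1 / z ^ 2)"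
      using nz by eventually_elim (simp add: h_def g_def field_simps power2_eq_square)
    show "\<forall>\<^sub>F z in at_infinity. 1 / z ^ 2 \<noteq> (0::complex)"
      using nz by eventually_elim simp
  qed
qed

text \<open>For large real \<open>x\<close> the bound reads \<open>norm c * x \<le> K\<close>, which
  forces \<open>c = 0\<close>. This is the uniqueness behind the description operator in
  \<open>beta\<close>.\<close>

lemma first_order_coefficient_unique:
  assumes "(\<lambda>z::complex. c / z) \<in> O[at_infinity](\<lambda>z. 1 / z ^ 2)"
  shows "c = 0"
proof (rule ccontr)
  assume "c \<noteq> 0"
  obtain K where K: "\<forall>\<^sub>F z in at_infinity. norm (c / z) \<le> K * norm (1 / z ^ 2 :: complex)"
    using landau_o.bigE[OF assms] by blast
  then obtain R where R: "\<And>z. norm z \<ge> R \<Longrightarrow> norm (c / z) \<le> K * norm (1 / z ^ 2 :: complex)"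
    unfolding eventually_at_infinity by blast
  define x where "x = max (max R 1) (\<bar>K\<bar> / norm c + 1)"
  have x: "x \<ge> R" "x \<ge> 1" "x > \<bar>K\<bar> / norm c"
    by (auto simp: x_def)
  have "norm c / x \<le> K / x ^ 2"
    using R[of "of_real x"] x by (simp add: norm_divide norm_power)
  then have "norm c * x \<le> K"
    using x by (simp add: field_simps power2_eq_square)
  moreover have "norm c * x > \<bar>K\<bar>"
    using x \<open>c \<noteq> 0\<close> by (simp add: field_simps)
  ultimately show False by simp
qed

text \<open>The coefficients of \<open>1 / z\<close> in the shifted tau functions: the tau matrix
  times \<open>beta\<close> where the tau matrix is invertible.\<close>

definition tau_w_deriv :: "('n::finite \<Rightarrow> 'n \<Rightarrow> 'n times \<Rightarrow> complex \<Rightarrow> complex) \<Rightarrow> 'n times \<Rightarrow> complex^'n^'n"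
  where "tau_w_deriv E t = (\<chi> a b. deriv (E a b t) 0)"

definition tau_u_deriv :: "('n::finite \<Rightarrow> 'n \<Rightarrow> 'n times \<Rightarrow> complex) \<Rightarrow> 'n \<Rightarrow> 'n times \<Rightarrow> complex^'n^'n"
  where "tau_u_deriv T l t = (\<chi> a b. deriv (\<lambda>u. T a b (u_update l t u)) (t l 0))"

definition tau_shift_u_deriv ::
  "('n::finite \<Rightarrow> 'n \<Rightarrow> 'n times \<Rightarrow> complex \<Rightarrow> complex) \<Rightarrow> complex \<Rightarrow> 'n \<Rightarrow> 'n \<Rightarrow> 'n times \<Rightarrow> complex^'n"
  where "tau_shift_u_deriv E w i l t = (\<chi> a. deriv (\<lambda>u. E a i (u_update l t u) w) (t l 0))"

text \<open>The kernel is \<open>(w - a) / (w + a)\<close>, split so that the pole at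
  \<open>- a\<close> falls under Cauchy's formula and the rest under the mean value
  property.\<close>

lemma circle_mean_kernel:
  assumes "f holomorphic_on ball 0 r" "r > 1" "norm a < 1"
  shows "circle_mean (\<lambda>w. (2 * (w / (w + a)) - 1) * f w) = 2 * f (- a) - f 0"
    and "a \<noteq> 0 \<Longrightarrow> circle_mean (\<lambda>w. (2 * (w / (w + a)) - 1) * f w / w)
      = 2 / a * f 0 - 2 / a * f (- a) - deriv f 0"
proof -
  have f: "continuous_on (sphere 0 1) f"
    by (rule continuous_on_subset[OF holomorphic_on_imp_continuous_on[OF assms(1)]])
       (use assms(2) in auto)
  have nz: "w + a \<noteq> 0" "w \<noteq> 0" if "norm w = 1" for w
    using that assms(3) by (auto simp: add_eq_0_iff norm_minus_cancel)
  have g: "continuous_on (sphere 0 1) (\<lambda>w. f w * (w / (w - - a)))"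
    by (intro continuous_intros f) (use nz in auto)
  have "circle_mean (\<lambda>w. (2 * (w / (w + a)) - 1) * f w)
      = circle_mean (\<lambda>w. 2 * (f w * (w / (w - - a))) - f w)"
    by (simp add: algebra_simps)
  also have "\<dots> = circle_mean (\<lambda>w. 2 * (f w * (w / (w - - a)))) - circle_mean f"
    by (intro circle_mean_diff continuous_intros f g)
  also have "\<dots> = 2 * f (- a) - f 0"
    unfolding circle_mean_cmult
    using circle_mean_Cauchy[OF assms(1,2), of "- a"] circle_mean_holomorphic[OF assms(1,2)] assms(3)
    by simp
  finally show "circle_mean (\<lambda>w. (2 * (w / (w + a)) - 1) * f w) = 2 * f (- a) - f 0" .
  assume a: "a \<noteq> 0"
  \<comment> \<open>Uses \<open>2 / (w + a) = 2 / a - 2 / a * (w / (w + a))\<close>; the last term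
    carries the double pole at 0 that yields \<open>deriv f 0\<close>.\<close>
  have "(2 * (w / (w + a)) - 1) * f w / w
      = 2 / a * f w - 2 / a * (f w * (w / (w - - a))) - f w / w" if "norm w = 1" for w
    using nz[OF that] a by (simp add: divide_simps) (simp add: algebra_simps)
  moreover have c1: "continuous_on (sphere 0 1) (\<lambda>w. 2 / a * f w)"
    and c2: "continuous_on (sphere 0 1) (\<lambda>w. 2 / a * (f w * (w / (w - - a))))"
    by (intro continuous_intros f g)+
  moreover have c3: "continuous_on (sphere 0 1) (\<lambda>w. f w / w)"
    by (intro continuous_intros f) (use nz in auto)
  ultimately have "circle_mean (\<lambda>w. (2 * (w / (w + a)) - 1) * f w / w)
      = circle_mean (\<lambda>w. 2 / a * f w - 2 / a * (f w * (w / (w - - a))) - f w / w)"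
    by (intro circle_mean_cong)
  also have "\<dots> = circle_mean (\<lambda>w. 2 / a * f w) - circle_mean (\<lambda>w. 2 / a * (f w * (w / (w - - a))))
      - circle_mean (\<lambda>w. f w / w)"
    by (simp only: circle_mean_diff continuous_on_diff c1 c2 c3)
  also have "\<dots> = 2 / a * f 0 - 2 / a * f (- a) - deriv f 0"
    unfolding circle_mean_cmult
    using circle_mean_Cauchy[OF assms(1,2), of "- a"] circle_mean_holomorphic[OF assms(1,2)]
      circle_mean_deriv[OF assms(1,2)] assms(3)
    by simp
  finally show "circle_mean (\<lambda>w. (2 * (w / (w + a)) - 1) * f w / w)
      = 2 / a * f 0 - 2 / a * f (- a) - deriv f 0" .
qed

section \<open>The matrix \<open>beta\<close> and the bilinear equation at equal times\<close>

context bkp_tau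
begin

lemma tau_u_deriv:
  assumes "t \<in> D"
  shows "((\<lambda>u. T a b (u_update l t u)) has_field_derivative tau_u_deriv T l t $ a $ b) (at (t l 0))"
  by (rule T_u_differentiable[OF assms, of a b l]) (simp add: tau_u_deriv_def DERIV_imp_deriv)

lemma tau_shift_u_deriv:
  assumes "t \<in> D" "norm w \<le> 1"
  shows "((\<lambda>u. E a i (u_update l t u) w) has_field_derivative tau_shift_u_deriv E w i l t $ a) (at (t l 0))"
  by (rule E_u_differentiable[OF assms, of a i l]) (simp add: tau_shift_u_deriv_def DERIV_imp_deriv)

text \<open>The first-order expansions of the extensions, multiplied by the inverse tau matrix, have
  the identity as constant term.\<close>

lemma beta_eq:
  assumes "t \<in> D" "invertible (tau_matrix T t)"
  shows "beta T E t = matrix_inv (tau_matrix T t) ** tau_w_deriv E t"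
proof -
  define P where "P = matrix_inv (tau_matrix T t)"
  have bigo: "(\<lambda>z. chi T E z t $ i $ j - (mat 1 :: complex^'n^'n) $ i $ j - (P ** tau_w_deriv E t) $ i $ j / z)
       \<in> O[at_infinity](\<lambda>z. 1 / z ^ 2)" for i j
  proof -
    have "(\<lambda>z. E a j t (1 / z) - T a j t - deriv (E a j t) 0 / z) \<in> O[at_infinity](\<lambda>z. 1 / z ^ 2)" for a
    proof -
      obtain r where "r > 1" "E a j t holomorphic_on ball 0 r"
        by (rule E_holomorphic[OF assms(1)])
      then show ?thesis
        using holomorphic_expansion_at_infinity[of "E a j t" r] by (simp add: E_0[OF assms(1)])
    qed
    then have "(\<lambda>z. \<Sum>a\<in>UNIV. P $ i $ a * (E a j t (1 / z) - T a j t - deriv (E a j t) 0 / z))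
        \<in> O[at_infinity](\<lambda>z. 1 / z ^ 2)"
      by (intro big_sum_in_bigo landau_o.big.cmult_in_iff'[THEN iffD2]) auto
    moreover have "(\<Sum>a\<in>UNIV. P $ i $ a * (E a j t (1 / z) - T a j t - deriv (E a j t) 0 / z))
        = chi T E z t $ i $ j - (P ** tau_matrix T t) $ i $ j - (P ** tau_w_deriv E t) $ i $ j / z" for z
      by (simp add: chi_def P_def tau_w_deriv_def tau_matrix_def matrix_matrix_mult_def
          right_diff_distrib sum_subtractf sum_divide_distrib)
    ultimately show ?thesis
      using matrix_inv_inverse(2)[OF assms(2)] by (simp add: P_def)
  qed
  show ?thesis
    unfolding beta_def P_def[symmetric]
  proof (rule the_equality)
    fix B :: "complex^'n^'n"
    assume B: "\<forall>i j. (\<lambda>z. chi T E z t $ i $ j - (mat 1 :: complex^'n^'n) $ i $ j - B $ i $ j / z)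
       \<in> O[at_infinity](\<lambda>z. 1 / z ^ 2)"
    have "(B - P ** tau_w_deriv E t) $ i $ j = 0" for i j
    proof (rule first_order_coefficient_unique)
      have "(\<lambda>z. (chi T E z t $ i $ j - (mat 1 :: complex^'n^'n) $ i $ j - (P ** tau_w_deriv E t) $ i $ j / z)
          - (chi T E z t $ i $ j - (mat 1 :: complex^'n^'n) $ i $ j - B $ i $ j / z))
          \<in> O[at_infinity](\<lambda>z. 1 / z ^ 2)"
        by (rule sum_in_bigo(2)) (use bigo B in auto)
      then show "(\<lambda>z. (B - P ** tau_w_deriv E t) $ i $ j / z) \<in> O[at_infinity](\<lambda>z. 1 / z ^ 2)"
        by (simp add: diff_divide_distrib)
    qed
    then show "B = P ** tau_w_deriv E t"
      by (simp add: vec_eq_iff)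
  qed (use bigo in blast)
qed

lemma E_product_holomorphic:
  assumes "s \<in> D" "t \<in> D"
  obtains r where "r > 1" "(\<lambda>w. E a k s w * E b k t (- w)) holomorphic_on ball 0 r"
proof -
  obtain r where r: "r > 1" "E a k s holomorphic_on ball 0 r" by (rule E_holomorphic[OF assms(1)])
  obtain r' where r': "r' > 1" "E b k t holomorphic_on ball 0 r'" by (rule E_holomorphic[OF assms(2)])
  have "E a k s holomorphic_on ball 0 (min r r')"
    by (rule holomorphic_on_subset[OF r(2)]) auto
  moreover have "(E b k t \<circ> uminus) holomorphic_on ball 0 (min r r')"
    by (rule holomorphic_on_compose_gen[OF _ r'(2)]) (auto intro!: holomorphic_intros)
  ultimately have "(\<lambda>w. E a k s w * E b k t (- w)) holomorphic_on ball 0 (min r r')"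
    by (auto simp: o_def intro: holomorphic_on_mult)
  with r r' show ?thesis by (intro that[of "min r r'"]) auto
qed

lemma E_product_deriv:
  assumes "s \<in> D" "t \<in> D"
  shows "deriv (\<lambda>w. E a k s w * E b k t (- w)) 0
    = tau_w_deriv E s $ a $ k * T b k t - T a k s * tau_w_deriv E t $ b $ k"
proof -
  have d: "(E a k s has_field_derivative tau_w_deriv E s $ a $ k) (at 0)" if s: "s \<in> D" for a s
  proof -
    obtain r where "r > 1" "E a k s holomorphic_on ball 0 r" by (rule E_holomorphic[OF s])
    then have "(E a k s has_field_derivative deriv (E a k s) 0) (at 0)"
      by (intro holomorphic_derivI[of _ "ball 0 r"]) auto
    then show ?thesis by (simp add: tau_w_deriv_def)
  qed
  have "((\<lambda>w. E b k t (- w)) has_field_derivative tau_w_deriv E t $ b $ k * - 1) (at 0)"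
    by (rule DERIV_chain2) (auto intro!: derivative_eq_intros d assms)
  from DERIV_mult[OF d[OF assms(1), of a] this] show ?thesis
    by (intro DERIV_imp_deriv) (simp add: E_0 assms algebra_simps)
qed

lemma circle_mean_E_product:
  assumes "s \<in> D" "t \<in> D"
  shows "circle_mean (\<lambda>w. E a k s w * E b k t (- w)) = T a k s * T b k t"
proof -
  obtain r where "r > 1" "(\<lambda>w. E a k s w * E b k t (- w)) holomorphic_on ball 0 r"
    by (rule E_product_holomorphic[OF assms])
  then show ?thesis
    using circle_mean_holomorphic E_0[OF assms(1), of a k] E_0[OF assms(2), of b k] by fastforce
qed

text \<open>At equal times the exponential factor is 1 and the integrand is holomorphic in the disc,
  so each mean is the value at \<open>w = 0\<close>.\<close>

lemma tau_matrix_commute: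
  assumes "t \<in> D"
  shows "tau_matrix T t ** transpose (tau_matrix T t) = transpose (tau_matrix T t) ** tau_matrix T t"
  using bilinear_circle_mean[OF assms assms, of "\<lambda>_ _. 1"]
  by (simp add: circle_mean_E_product assms vec_eq_iff tau_matrix_def matrix_matrix_mult_def transpose_def)

text \<open>The second time stays fixed at \<open>t\<close>. The right side is the derivative of the
  integrand at \<open>w = 0\<close>, with a minus sign from the argument \<open>- w\<close> of the
  second factor.\<close>

lemma tau_matrix_commute_deriv:
  assumes "t \<in> D"
  shows "transpose (tau_u_deriv T l t) ** tau_matrix T t - tau_u_deriv T l t ** transpose (tau_matrix T t)
      = outer (column l (tau_w_deriv E t)) (column l (tau_matrix T t))
        - outer (column l (tau_matrix T t)) (column l (tau_w_deriv E t))"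
proof -
  have "(\<Sum>k\<in>UNIV. tau_u_deriv T l t $ k $ a * T k b t) - (\<Sum>k\<in>UNIV. tau_u_deriv T l t $ a $ k * T b k t)
      = tau_w_deriv E t $ a $ l * T b l t - T a l t * tau_w_deriv E t $ b $ l" for a b
  proof -
    obtain d where d: "d > 0" "\<And>u. u \<in> ball (t l 0) d \<Longrightarrow> u_update l t u \<in> D"
      by (rule u_update_local[OF assms, where l = l and i = a and j = b]) blast
    have mean: "circle_mean (\<lambda>w. E a l t w * E b l t (- w) / w)
        = tau_w_deriv E t $ a $ l * T b l t - T a l t * tau_w_deriv E t $ b $ l"
      by (rule E_product_holomorphic[OF assms assms, of a l b])
         (simp add: circle_mean_deriv E_product_deriv assms)
    have "((\<lambda>u. (\<Sum>k\<in>UNIV. T k a (u_update l t u) * T k b t)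
          - (\<Sum>k\<in>UNIV. circle_mean (\<lambda>w. E a k (u_update l t u) w * E b k t (- w))))
        has_field_derivative tau_w_deriv E t $ a $ l * T b l t - T a l t * tau_w_deriv E t $ b $ l) (at (t l 0))"
      using bilinear_u_derivative[OF assms assms, of "\<lambda>_ _. 1" a l b] by (simp add: mean)
    then have "((\<lambda>u. (\<Sum>k\<in>UNIV. T k a (u_update l t u) * T k b t) - (\<Sum>k\<in>UNIV. T a k (u_update l t u) * T b k t))
        has_field_derivative tau_w_deriv E t $ a $ l * T b l t - T a l t * tau_w_deriv E t $ b $ l) (at (t l 0))"
      by (rule has_field_derivative_transform_within_open[where S = "ball (t l 0) d"])
         (use d assms in \<open>auto simp: circle_mean_E_product\<close>)
    moreover have "((\<lambda>u. (\<Sum>k\<in>UNIV. T k a (u_update l t u) * T k b t) - (\<Sum>k\<in>UNIV. T a k (u_update l t u) * T b k t))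
        has_field_derivative (\<Sum>k\<in>UNIV. tau_u_deriv T l t $ k $ a * T k b t)
          - (\<Sum>k\<in>UNIV. tau_u_deriv T l t $ a $ k * T b k t)) (at (t l 0))"
      by (intro DERIV_diff DERIV_sum DERIV_cmult_right tau_u_deriv assms)
    ultimately show ?thesis
      using DERIV_unique by blast
  qed
  then show ?thesis
    by (simp add: vec_eq_iff tau_matrix_def matrix_matrix_mult_def transpose_def outer_def column_def)
qed

end

section \<open>The shifted bilinear equation\<close>

lemma psi_eq_exp: "psi T E (- p) t $ k $ i
    = exp (xi (- p) (t i)) * (matrix_inv (tau_matrix T t) *v (\<chi> a. E a i t (- (1 / p)))) $ k"
  by (simp add: psi_def phi_def matrix_matrix_mult_def matrix_vector_mult_def sum_distrib_left mult_ac)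

text \<open>For \<open>k = i\<close> this is \<open>(p - z) / (p + z)\<close> with
  \<open>z = 1 / w\<close>, in the form used by \<open>circle_mean_kernel\<close>.\<close>

definition shift_kernel :: "'n \<Rightarrow> complex \<Rightarrow> 'n \<Rightarrow> complex \<Rightarrow> complex" where
  "shift_kernel i p k w = (if k = i then 2 * (w / (w + 1 / p)) - 1 else 1)"

lemma shift_inverse: "shift i (- w) (shift i w t) = t"
  by (simp add: shift_def bracket_minus)

context bkp_tau
begin

text \<open>Needed at the pole \<open>w = - 1 / p\<close>, where the second factor has argument
  \<open>1 / p\<close> and the two shifts cancel.\<close>

lemma E_shift_back:
  assumes "t \<in> D" "norm p > 1"
  shows "E a i (shift i (1 / p) t) (1 / p) = T a i t"
proof -
  have "E a i (shift i (1 / p) t) (1 / p) = T a i (shift i (- 1 / p) (shift i (1 / p) t))"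
    using extension shift_in_times[OF assms] assms(2) unfolding tau_extension_def by blast
  then show ?thesis
    using shift_inverse[of i "1 / p" t] by simp
qed

lemma continuous_on_shift_kernel:
  assumes "norm p > 1"
  shows "continuous_on (sphere 0 1) (shift_kernel i p k)"
proof -
  have "w + 1 / p \<noteq> 0" if "norm w = 1" for w
  proof
    assume "w + 1 / p = 0"
    then have "norm w = norm (1 / p)"
      by (simp add: add_eq_0_iff)
    then show False using that assms by (simp add: norm_divide)
  qed
  then show ?thesis
    by (cases "k = i") (auto simp: shift_kernel_def[abs_def] intro!: continuous_intros)
qed

lemma exp_xi_shift:
  assumes "t \<in> D" "norm p > 1" "norm w = 1"
  shows "exp (xi (1 / w) (t k) - xi (1 / w) (shift i (1 / p) t k)) = shift_kernel i p k w"
proof (cases "k = i")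
  case True
  define z where "z = 1 / w"
  have z: "norm z = 1" "norm (z * (1 / p)) < 1"
    using assms by (auto simp: z_def norm_divide norm_mult divide_less_eq_1)
  have w: "w \<noteq> 0" "p \<noteq> 0" "w * p + 1 \<noteq> 0" "w * p - 1 \<noteq> 0"
  proof -
    show "w \<noteq> 0" "p \<noteq> 0" using assms by auto
    have "norm (w * p) > 1" using assms by (simp add: norm_mult)
    then show "w * p + 1 \<noteq> 0" "w * p - 1 \<noteq> 0" by (auto simp: add_eq_0_iff2)
  qed
  have "xi z (shift i (1 / p) t i) = xi z (t i) + xi z (bracket (1 / p))"
    unfolding xi_def shift_def using suminf_add[OF times_summable[OF assms(1), of z i]
      exp_xi_bracket(1)[OF z(2)]] z
    by (simp add: distrib_left)
  then have "exp (xi z (t i) - xi z (shift i (1 / p) t i)) = 1 / exp (xi z (bracket (1 / p)))"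
    by (simp add: exp_minus inverse_eq_divide)
  also have "\<dots> = (1 - 1 / (w * p)) / (1 + 1 / (w * p))"
    unfolding exp_xi_bracket(2)[OF z(2)] by (simp add: z_def)
  also have "\<dots> = (w * p - 1) / (w * p + 1)"
    using w(1,2) by (simp add: divide_simps)
  also have "\<dots> = 2 * (w * p / (w * p + 1)) - 1"
    using w(3) by (simp add: divide_simps)
  also have "w * p / (w * p + 1) = w / (w + 1 / p)"
    using w(2) by (simp add: divide_simps)
  also have "2 * (w / (w + 1 / p)) - 1 = shift_kernel i p i w"
    by (simp add: shift_kernel_def)
  finally show ?thesis using True by (simp add: z_def)
next
  case False
  then show ?thesis by (simp add: shift_def shift_kernel_def)
qed

text \<open>The first factor has a time \<open>s\<close> of its own, because it will move with
  \<open>u_l\<close> while the kernel and the second time stay fixed.\<close>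

lemma circle_mean_shift_kernel:
  assumes "s \<in> D" "t \<in> D" "norm p > 1"
  shows "circle_mean (\<lambda>w. shift_kernel i p k w * E a k s w * E b k (shift i (1 / p) t) (- w))
      = T a k s * T b k (shift i (1 / p) t)
        + (if k = i then 2 * (E a i s (- (1 / p)) * T b i t - T a i s * T b i (shift i (1 / p) t)) else 0)"
    and "circle_mean (\<lambda>w. shift_kernel i p k w * E a k s w * E b k (shift i (1 / p) t) (- w) / w)
      = (if k = i then 2 * p * (T a i s * T b i (shift i (1 / p) t) - E a i s (- (1 / p)) * T b i t) else 0)
        + (if k = i then -1 else 1) * (tau_w_deriv E s $ a $ k * T b k (shift i (1 / p) t)
          - T a k s * tau_w_deriv E (shift i (1 / p) t) $ b $ k)"
proof -
  define t' where "t' = shift i (1 / p) t"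
  have t': "t' \<in> D"
    unfolding t'_def by (rule shift_in_times[OF assms(2,3)])
  define f where "f w = E a k s w * E b k t' (- w)" for w
  obtain r where r: "f holomorphic_on ball 0 r" "r > 1"
    unfolding f_def[abs_def] by (rule E_product_holomorphic[OF assms(1) t'])
  have p: "norm (1 / p) < 1" "1 / p \<noteq> 0"
    using assms(3) by (auto simp: norm_divide divide_less_eq_1)
  have f0: "f 0 = T a k s * T b k t'" and fp: "k = i \<Longrightarrow> f (- (1 / p)) = E a i s (- (1 / p)) * T b i t"
    using assms t' by (simp_all add: f_def E_0) (simp add: t'_def E_shift_back)
  have f': "deriv f 0 = tau_w_deriv E s $ a $ k * T b k t' - T a k s * tau_w_deriv E t' $ b $ k"
    unfolding f_def[abs_def] by (rule E_product_deriv[OF assms(1) t'])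
  show "circle_mean (\<lambda>w. shift_kernel i p k w * E a k s w * E b k (shift i (1 / p) t) (- w))
      = T a k s * T b k (shift i (1 / p) t)
        + (if k = i then 2 * (E a i s (- (1 / p)) * T b i t - T a i s * T b i (shift i (1 / p) t)) else 0)"
    unfolding t'_def[symmetric] mult.assoc f_def[symmetric]
    using circle_mean_kernel(1)[OF r p(1)] circle_mean_holomorphic[OF r] f0 fp
    by (auto simp: shift_kernel_def algebra_simps)
  show "circle_mean (\<lambda>w. shift_kernel i p k w * E a k s w * E b k (shift i (1 / p) t) (- w) / w)
      = (if k = i then 2 * p * (T a i s * T b i (shift i (1 / p) t) - E a i s (- (1 / p)) * T b i t) else 0)
        + (if k = i then -1 else 1) * (tau_w_deriv E s $ a $ k * T b k (shift i (1 / p) t)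
          - T a k s * tau_w_deriv E (shift i (1 / p) t) $ b $ k)"
    unfolding t'_def[symmetric] mult.assoc f_def[symmetric]
    using circle_mean_kernel(2)[OF r p] circle_mean_deriv[OF r] f0 fp f'
    by (auto simp: shift_kernel_def algebra_simps)
qed

lemma tau_matrix_shift:
  fixes i
  assumes "t \<in> D" "norm p > 1"
  defines "A \<equiv> tau_matrix T t" and "A' \<equiv> tau_matrix T (shift i (1 / p) t)"
  shows "A ** transpose A' - outer (2 *s column i A) (column i A')
      + outer (2 *s column i A') (column i A) = transpose A ** A'"
proof -
  define t' where "t' = shift i (1 / p) t"
  have "(\<Sum>k\<in>UNIV. T a k t * T b k t') + 2 * (T a i t' * T b i t - T a i t * T b i t')
      = (\<Sum>k\<in>UNIV. T k a t * T k b t')" for a b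
    using bilinear_circle_mean[OF assms(1) shift_in_times[OF assms(1,2), of i],
        of "shift_kernel i p" a b, OF continuous_on_shift_kernel[OF assms(2)]
        exp_xi_shift[OF assms(1,2)]]
    by (simp add: circle_mean_shift_kernel assms(1,2) sum.distrib E_shift t'_def)
  then show ?thesis
    by (simp add: vec_eq_iff A_def A'_def tau_matrix_def matrix_matrix_mult_def transpose_def
        outer_def column_def t'_def algebra_simps)
qed

lemma tau_matrix_shift_deriv:
  fixes i l
  assumes "t \<in> D" "norm p > 1"
  defines "A \<equiv> tau_matrix T t" and "A' \<equiv> tau_matrix T (shift i (1 / p) t)"
    and "dA \<equiv> tau_u_deriv T l t" and "B \<equiv> tau_w_deriv E t"
    and "dE \<equiv> tau_shift_u_deriv E (- (1 / p)) i l t"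
  obtains y where "transpose dA ** A' - (dA ** transpose A' - outer (2 *s column i dA) (column i A')
        + outer (2 *s dE) (column i A))
      = outer ((if l = i then -1 else 1) *s column l B) (column l A') + outer (column l A) y
        - outer ((if l = i then 2 * p else 0) *s column i A') (column i A)"
proof -
  define t' where "t' = shift i (1 / p) t"
  have t': "t' \<in> D"
    unfolding t'_def by (rule shift_in_times[OF assms(1,2)])
  have p: "norm (- (1 / p)) \<le> 1"
    using assms(2) by (auto simp: norm_divide divide_le_eq_1)
  define B' where "B' = tau_w_deriv E t'"
  define J where "J a b = (if l = i then 2 * p * (T a i t * T b i t' - T a i t' * T b i t) else 0)
        + (if l = i then -1 else 1) * (B $ a $ l * T b l t' - T a l t * B' $ b $ l)" for a b
  have J: "(\<Sum>k\<in>UNIV. dA $ k $ a * T k b t') - ((\<Sum>k\<in>UNIV. dA $ a $ k * T b k t')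
      + 2 * (dE $ a * T b i t - dA $ a $ i * T b i t')) = J a b" for a b
  proof -
    obtain d where d: "d > 0" "\<And>u. u \<in> ball (t l 0) d \<Longrightarrow> u_update l t u \<in> D"
      by (rule u_update_local[OF assms(1), where l = l and i = a and j = b]) blast
    have mean: "circle_mean (\<lambda>w. shift_kernel i p l w * E a l t w * E b l t' (- w) / w) = J a b"
      by (simp add: circle_mean_shift_kernel(2) t'_def J_def B_def B'_def E_shift assms(1,2))
    have "((\<lambda>u. (\<Sum>k\<in>UNIV. T k a (u_update l t u) * T k b t')
          - (\<Sum>k\<in>UNIV. circle_mean (\<lambda>w. shift_kernel i p k w * E a k (u_update l t u) w * E b k t' (- w))))
        has_field_derivative J a b) (at (t l 0))"
      using bilinear_u_derivative[OF assms(1) t', of "shift_kernel i p" a l b,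
          OF continuous_on_shift_kernel[OF assms(2)] exp_xi_shift[OF assms(1,2), where i = i, folded t'_def]]
      unfolding mean .
    \<comment> \<open>Near \<open>t l 0\<close> the means have a closed form, which can be
      differentiated term by term.\<close>
    then have "((\<lambda>u. (\<Sum>k\<in>UNIV. T k a (u_update l t u) * T k b t')
          - ((\<Sum>k\<in>UNIV. T a k (u_update l t u) * T b k t')
            + 2 * (E a i (u_update l t u) (- (1 / p)) * T b i t - T a i (u_update l t u) * T b i t')))
        has_field_derivative J a b) (at (t l 0))"
      by (rule has_field_derivative_transform_within_open[where S = "ball (t l 0) d"])
         (use d assms(1,2) in \<open>auto simp: t'_def circle_mean_shift_kernel sum.distrib\<close>)
    moreover have "((\<lambda>u. (\<Sum>k\<in>UNIV. T k a (u_update l t u) * T k b t')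
          - ((\<Sum>k\<in>UNIV. T a k (u_update l t u) * T b k t')
            + 2 * (E a i (u_update l t u) (- (1 / p)) * T b i t - T a i (u_update l t u) * T b i t')))
        has_field_derivative (\<Sum>k\<in>UNIV. dA $ k $ a * T k b t') - ((\<Sum>k\<in>UNIV. dA $ a $ k * T b k t')
      + 2 * (dE $ a * T b i t - dA $ a $ i * T b i t'))) (at (t l 0))"
      unfolding dA_def dE_def
      by (intro DERIV_diff DERIV_add DERIV_cmult DERIV_sum DERIV_cmult_right tau_u_deriv
          tau_shift_u_deriv assms(1) p)
    ultimately show ?thesis
      using DERIV_unique by blast
  qed
  \<comment> \<open>Collects all terms of \<open>J\<close> that contain column \<open>l\<close> of
    \<open>A\<close>; multiplication by row \<open>k\<close> of the inverse annihilates them for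
    \<open>k \<noteq> l\<close>.\<close>
  define y where "y = (if l = i then (2 * p) *s column i A' + column i B' else - column l B')"
  have "transpose dA ** A' - (dA ** transpose A' - outer (2 *s column i dA) (column i A')
        + outer (2 *s dE) (column i A)) = (\<chi> a b. J a b)"
    unfolding J[symmetric]
    by (simp add: vec_eq_iff A_def A'_def tau_matrix_def matrix_matrix_mult_def transpose_def
        outer_def column_def t'_def algebra_simps)
  also have "\<dots> = outer ((if l = i then -1 else 1) *s column l B) (column l A') + outer (column l A) y
        - outer ((if l = i then 2 * p else 0) *s column i A') (column i A)"
    by (simp add: vec_eq_iff A_def A'_def tau_matrix_def y_def J_def outer_def column_def
        t'_def algebra_simps)
  finally show ?thesis by (rule that)
qed

lemma commuting_transpose_tau_matrix:
  assumes "t \<in> D" "invertible (tau_matrix T t)"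
  shows "commuting_transpose (tau_matrix T t) (matrix_inv (tau_matrix T t))"
  by unfold_locales (simp_all add: matrix_inv_inverse assms tau_matrix_commute)

section \<open>The linear systems for the frame and for the transformation data\<close>

lemma orthonormal_frame:
  assumes "t \<in> D" "invertible (tau_matrix T t)"
  shows "orthonormal_frame_at (beta T E) (frame T) t"
proof -
  define A P where "A = tau_matrix T t" and "P = matrix_inv A"
  interpret commuting_transpose A P
    unfolding A_def P_def by (rule commuting_transpose_tau_matrix[OF assms])
  have "(\<Sum>m\<in>UNIV. frame T j t $ m * frame T k t $ m) = (if j = k then 1 else 0)" for j k
    using dot_rows[of j G k, unfolded G_orthogonal]
    by (simp add: mat_def dot_def frame_def G_matrix_def A_def P_def)
  moreover have "has_u_derivative (\<lambda>s. frame T k s $ m) (beta T E t $ k $ l * frame T l t $ m) l t"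
    if "k \<noteq> l" for k l m
  proof -
    define dA where "dA = tau_u_deriv T l t"
    have dA: "((\<lambda>u. tau_matrix T (u_update l t u) $ a $ b) has_field_derivative dA $ a $ b) (at (t l 0))" for a b
      unfolding dA_def by (simp add: tau_matrix_def tau_u_deriv[OF assms(1)])
    \<comment> \<open>Row \<open>m\<close> of the tau matrix is column \<open>m\<close> of its
      transpose, so the \<open>m\<close>-th components of the frame vectors solve a linear
      system.\<close>
    have "((\<lambda>u. (matrix_inv (tau_matrix T (u_update l t u)) *v row m (tau_matrix T (u_update l t u))) $ k)
      has_field_derivative (P *v (row m dA - dA *v (P *v row m A))) $ k) (at (t l 0))"
      using matrix_inv_mult_derivative[of "\<lambda>u. tau_matrix T (u_update l t u)" dA "t l 0"
          "\<lambda>u. row m (tau_matrix T (u_update l t u))" "row m dA" k, OF dA] dA assms(2)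
      by (simp add: row_def A_def P_def)
    moreover have "(matrix_inv X *v row m X) $ k = row k (matrix_inv X ** transpose X) $ m" for X :: "complex^'n^'n"
      using matrix_vector_column_component[of "matrix_inv X" m "transpose X" k]
      by (simp add: column_transpose row_def)
    moreover have "(P *v (row m dA - dA *v (P *v row m A))) $ k
        = row k (P ** (transpose dA - dA ** G)) $ m"
    proof -
      have "row m dA - dA *v (P *v row m A) = column m (transpose dA - dA ** G)"
        by (simp add: vec_eq_iff column_def matrix_vector_column_component flip: column_transpose)
           (simp add: column_def matrix_vector_mult_column flip: matrix_vector_column_component)
      then show ?thesis
        by (simp add: matrix_vector_column_component row_def)
    qed
    moreover have "row k (P ** (transpose dA - dA ** G)) = (P ** tau_w_deriv E t) $ k $ l *s row l G"
      using tau_matrix_commute_deriv[OF assms(1)] \<open>k \<noteq> l\<close> unfolding dA_def A_def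
      by (intro G_row_derivative[unfolded A_def]) auto
    ultimately show ?thesis
      by (simp add: has_u_derivative_def frame_def G_matrix_def A_def P_def
          beta_eq[OF assms] flip: u_update_def)
  qed
  ultimately show ?thesis
    unfolding orthonormal_frame_at_def by blast
qed

text \<open>The exponential factor contributes \<open>- p\<close> exactly when \<open>l = i\<close>,
  cancelling the extra term of \<open>wave_derivative\<close>.\<close>

lemma psi_u_derivative:
  assumes "t \<in> D" "invertible (tau_matrix T t)" "norm p > 1" "xi_converges (norm p) (t i)"
    and "invertible (tau_matrix T (shift i (1 / p) t))" "k \<noteq> l"
  shows "has_u_derivative (\<lambda>s. psi T E (- p) s $ k $ i) (beta T E t $ k $ l * psi T E (- p) t $ l $ i) l t"
proof -
  define A P where "A = tau_matrix T t" and "P = matrix_inv A"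
  define A' P' where "A' = tau_matrix T (shift i (1 / p) t)" and "P' = matrix_inv A'"
  interpret bilinear_shift A P A' P' i
    unfolding A_def P_def A'_def P'_def
    by (intro bilinear_shift.intro bilinear_shift_axioms.intro commuting_transpose_tau_matrix
        tau_matrix_shift assms shift_in_times)
  define dA B dE where "dA = tau_u_deriv T l t" and "B = tau_w_deriv E t"
    and "dE = tau_shift_u_deriv E (- (1 / p)) i l t"
  define X where "X u = (matrix_inv (tau_matrix T (u_update l t u))
      *v (\<chi> a. E a i (u_update l t u) (- (1 / p)))) $ k" for u
  have p: "norm (- (1 / p)) \<le> 1"
    using assms(3) by (auto simp: norm_divide divide_le_eq_1)
  have v: "(\<chi> a. E a i t (- (1 / p))) = column i A'"
    by (simp add: vec_eq_iff column_def A'_def tau_matrix_def E_shift assms)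
  have "(X has_field_derivative (P *v (dE - dA *v v)) $ k) (at (t l 0))"
    unfolding X_def[abs_def] v_def
    using matrix_inv_mult_derivative[of "\<lambda>u. tau_matrix T (u_update l t u)" dA "t l 0"
        "\<lambda>u. \<chi> a. E a i (u_update l t u) (- (1 / p))" dE k] assms(2) p
    by (simp add: dA_def dE_def tau_matrix_def tau_u_deriv tau_shift_u_deriv assms(1) v P_def A_def)
  moreover obtain y where "transpose dA ** A' - (dA ** transpose A' - outer (2 *s column i dA) (column i A')
        + outer (2 *s dE) (column i A))
      = outer ((if l = i then -1 else 1) *s column l B) (column l A') + outer (column l A) y
        - outer ((if l = i then 2 * p else 0) *s column i A') (column i A)"
    unfolding dA_def A'_def A_def B_def dE_def by (rule tau_matrix_shift_deriv[OF assms(1,3)])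
  ultimately have X: "(X has_field_derivative (P ** B) $ k $ l * v $ l + (if l = i then p else 0) * v $ k) (at (t l 0))"
    using wave_derivative[of dA l B dE y p k] tau_matrix_commute_deriv[OF assms(1)] assms(6)
    by (simp add: A_def dA_def B_def)
  define c where "c = exp (xi (- p) (t i))"
  \<comment> \<open>By convergence at \<open>- p\<close>, changing the first coefficient alters the
    sum by that one term.\<close>
  have "xi (- p) (u_update l t u i) = xi (- p) (t i) + (if l = i then - p * (u - t l 0) else 0)" for u
    using xi_fun_upd_0(2)[OF xi_converges_summable[OF assms(4)], of "- p" u]
    by (simp add: u_update_def)
  then have "psi T E (- p) (u_update l t u) $ k $ i
      = c * exp (if l = i then - p * (u - t l 0) else 0) * X u" for u
    by (simp add: psi_eq_exp X_def c_def exp_add)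
  moreover have "((\<lambda>u. c * exp (if l = i then - p * (u - t l 0) else 0) * X u)
      has_field_derivative c * ((P ** B) $ k $ l * v $ l)) (at (t l 0))"
  proof -
    have X0: "X (t l 0) = v $ k"
      by (simp add: X_def v v_def flip: A_def P_def)
    have "((\<lambda>u. c * exp (if l = i then - p * (u - t l 0) else 0))
        has_field_derivative c * (if l = i then - p else 0)) (at (t l 0))"
      by (cases "l = i") (auto intro!: derivative_eq_intros)
    from DERIV_mult[OF this X] show ?thesis
      by (rule DERIV_cong) (simp add: X0 algebra_simps)
  qed
  moreover have "psi T E (- p) t $ l $ i = c * v $ l"
    by (simp add: psi_eq_exp c_def v v_def flip: A_def P_def)
  ultimately show ?thesis
    by (simp add: has_u_derivative_def beta_eq[OF assms(1,2)] A_def P_def B_def mult_ac flip: u_update_def)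
qed

end

theorem theorem2:
  fixes D :: "'n::finite times set"
    and tau :: "'n times \<Rightarrow> complex"
    and T :: "'n \<Rightarrow> 'n \<Rightarrow> 'n times \<Rightarrow> complex"
    and E :: "'n \<Rightarrow> 'n \<Rightarrow> 'n times \<Rightarrow> complex \<Rightarrow> complex"
    and i :: 'n and p :: complex and t :: "'n times"
  assumes "bkp_tau D tau T E"
    and "norm p > 1"
    and "t \<in> D"
    and "invertible (tau_matrix T t)"
    and "invertible (tau_matrix T (shift i (1 / p) t))"
    and "xi_converges (norm p) (t i)"
  shows "let \<zeta> = (\<lambda>k s. psi T E (- p) s $ k $ i) in
    orthonormal_frame_at (beta T E) (frame T) t \<and>
    transformation_data_at (beta T E) \<zeta> t \<and>
    (\<Sum>k\<in>UNIV. (\<zeta> k t)\<^sup>2) \<noteq> 0 \<and>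
    (\<forall>j. ribaucour \<zeta> (frame T) j t
         = (- 1) ^ of_bool (i = j) *s vertex_op i p (frame T j) t)"
proof -
  interpret bkp_tau D tau T E by (rule assms(1))
  define A P where "A = tau_matrix T t" and "P = matrix_inv A"
  define A' P' where "A' = tau_matrix T (shift i (1 / p) t)" and "P' = matrix_inv A'"
  interpret bilinear_shift A P A' P' i
    unfolding A_def P_def A'_def P'_def
    by (intro bilinear_shift.intro bilinear_shift_axioms.intro commuting_transpose_tau_matrix
        tau_matrix_shift assms shift_in_times)
  define \<zeta> where "\<zeta> = (\<lambda>k s. psi T E (- p) s $ k $ i)"
  define c where "c = exp (xi (- p) (t i))"
  have "c \<noteq> 0" by (simp add: c_def)
  have \<zeta>: "\<zeta> k t = c * v $ k" for k
  proof -
    have "(\<chi> a. E a i t (- (1 / p))) = column i A'"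
      by (simp add: vec_eq_iff column_def A'_def tau_matrix_def E_shift assms)
    then show ?thesis
      by (simp add: \<zeta>_def psi_eq_exp c_def v_def flip: A_def P_def)
  qed
  have sum: "(\<Sum>k\<in>UNIV. (\<zeta> k t)\<^sup>2) = c\<^sup>2 * dot v v"
    by (simp add: \<zeta> dot_def sum_distrib_left power2_eq_square mult_ac)
  have "ribaucour \<zeta> (frame T) j t = (- 1) ^ of_bool (i = j) *s vertex_op i p (frame T j) t" for j
  proof -
    have "(\<Sum>k\<in>UNIV. \<zeta> k t *s frame T k t) = c *s (\<Sum>k\<in>UNIV. v $ k *s row k t.G)"
      by (simp add: \<zeta> frame_def G_matrix_def A_def P_def vec_eq_iff sum_distrib_left mult.assoc)
    \<comment> \<open>The formula is homogeneous of degree 0 in the transformation data, so the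
      common factor \<open>c\<close> cancels.\<close>
    then have "(2 * \<zeta> j t / (\<Sum>k\<in>UNIV. (\<zeta> k t)\<^sup>2)) *s (\<Sum>k\<in>UNIV. \<zeta> k t *s frame T k t)
        = (2 * v $ j / dot v v) *s (\<Sum>k\<in>UNIV. v $ k *s row k t.G)"
      unfolding sum unfolding \<zeta> using \<open>c \<noteq> 0\<close> by (simp add: power2_eq_square)
    then have "ribaucour \<zeta> (frame T) j t
        = row j t.G - (2 * v $ j / dot v v) *s (\<Sum>k\<in>UNIV. v $ k *s row k t.G)"
      by (simp add: ribaucour_def) (simp add: frame_def G_matrix_def A_def P_def)
    then show ?thesis
      unfolding reflection(2)
      by (simp add: vertex_op_def frame_def G_matrix_def A'_def P'_def)
  qed
  moreover have "transformation_data_at (beta T E) \<zeta> t"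
    unfolding transformation_data_at_def \<zeta>_def using psi_u_derivative assms by blast
  moreover have "(\<Sum>k\<in>UNIV. (\<zeta> k t)\<^sup>2) \<noteq> 0"
    using reflection(1) \<open>c \<noteq> 0\<close> by (simp add: sum)
  ultimately show ?thesis
    using orthonormal_frame[OF assms(3,4)] unfolding Let_def \<zeta>_def[symmetric] by blast
qed

end
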